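(* Let $n\geq 1$ and $k>0$, and consider the Euler-Poisson equations in $\mathbb{R}^n$ $$ \left\{\begin{array}{l} \partial_t \rho+ \mathrm{div}\,(\rho v)=0,\\ \partial_t (\rho v)+\mathrm{div}\,(\rho v\otimes v) =-k\rho \nabla \phi,\\ \Delta \phi =\rho,\\ v(x,0)=v_0 (x), \quad \rho(x,0)=\rho_0 (x). \end{array}\right. $$ Suppose the initial data $(v_0,\rho_0)$ satisfies $$ \mathcal{S}_1=\left\{a\in \mathbb{R}^n \;\middle|\; \Omega_0 (a)=0,\ \ -\mathrm{div}\, v_0 (a) \geq \sqrt{\frac{2k\rho_0 (a)}{3}} >0\right\}\neq\emptyset . $$ Then the $C^1$-regularity of the local classical solution with initial data $(v_0, \rho_0)$ cannot persist for an arbitrarily long time; that is, the classical solution with initial data $(v_0,\rho_0)$ cannot remain of class $C^1$ for all $t\ge 0$.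
   Context: The unknowns are the velocity field $v=(v^1,\dots,v^n)=v(x,t)$, the mass density $\rho=\rho(x,t)\ge 0$, and the potential $\phi=\phi(x,t)$, for $x\in\mathbb{R}^n$, $t\geq 0$. The constant $k>0$ corresponds to an attractive force. The vorticity matrix of an $n$-dimensional vector field $v$ is $\Omega=(\Omega_{ij})$ with $\Omega_{ij}:=\partial_i v^j-\partial_j v^i$, $i,j=1,\dots,n$; in the case $n=1$ one sets $\Omega\equiv 0$. $\Omega_0$ denotes the vorticity matrix of $v_0$.
   Formalization: Proved for classical solutions whose particle paths starting where ρ₀ > 0 stay bounded on bounded time intervals; without such a condition at infinity the potential's free harmonic part can carry the mass to infinity in finite time when n ≥ 2, and the claim fails. *)

theory Defs
  imports "HOL-Analysis.Analysis"
begin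

definition partial_deriv :: "'n::finite \<Rightarrow> (real^'n \<Rightarrow> real) \<Rightarrow> real^'n \<Rightarrow> real" where
  "partial_deriv i f x = deriv (\<lambda>s. f (x + s *\<^sub>R axis i 1)) 0"

definition divergence :: "(real^'n::finite \<Rightarrow> real^'n) \<Rightarrow> real^'n \<Rightarrow> real" where
  "divergence F x = (\<Sum>i\<in>UNIV. partial_deriv i (\<lambda>y. F y $ i) x)"

definition laplacian :: "(real^'n::finite \<Rightarrow> real) \<Rightarrow> real^'n \<Rightarrow> real" where
  "laplacian f x = (\<Sum>i\<in>UNIV. partial_deriv i (partial_deriv i f) x)"

definition vorticity :: "(real^'n::finite \<Rightarrow> real^'n) \<Rightarrow> real^'n \<Rightarrow> real^'n^'n" where
  "vorticity w x = (\<chi> i j. partial_deriv i (\<lambda>y. w y $ j) x - partial_deriv j (\<lambda>y. w y $ i) x)"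

text \<open>Derivative in time on the half-line: one-sided at \<open>t = 0\<close>, two-sided for \<open>t > 0\<close>.\<close>

definition time_deriv :: "(real \<Rightarrow> real) \<Rightarrow> real \<Rightarrow> real" where
  "time_deriv f t = vector_derivative f (at t within {0..})"

definition C1_on :: "('a::real_normed_vector \<Rightarrow> 'b::real_normed_vector) \<Rightarrow> 'a set \<Rightarrow> bool" where
  "C1_on f S \<longleftrightarrow>
     (\<exists>f'. (\<forall>z\<in>S. (f has_derivative blinfun_apply (f' z)) (at z within S)) \<and> continuous_on S f')"

text \<open>\<open>\<phi>(\<cdot>,t)\<close> is twice differentiable for every \<open>t \<ge> 0\<close>, and its gradient \<open>g\<close> and
  Hessian \<open>H\<close> are jointly continuous in \<open>(x,t)\<close>.  Nothing is asked of the dependence of \<open>\<phi>\<close>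
  itself on \<open>t\<close>, since only \<open>\<nabla>\<phi>\<close> and \<open>\<Delta>\<phi>\<close> enter the equations.\<close>

definition C2_in_space :: "(real^'n::finite \<Rightarrow> real \<Rightarrow> real) \<Rightarrow> bool" where
  "C2_in_space \<phi> \<longleftrightarrow>
     (\<exists>(g :: real^'n \<Rightarrow> real \<Rightarrow> real^'n) (H :: real^'n \<Rightarrow> real \<Rightarrow> real^'n^'n).
        (\<forall>x. \<forall>t\<ge>0. ((\<lambda>y. \<phi> y t) has_derivative (\<lambda>h. g x t \<bullet> h)) (at x)) \<and>
        (\<forall>x. \<forall>t\<ge>0. ((\<lambda>y. g y t) has_derivative (\<lambda>h. H x t *v h)) (at x)) \<and>
        continuous_on (UNIV \<times> {0..}) (\<lambda>(x, t). g x t) \<and>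
        continuous_on (UNIV \<times> {0..}) (\<lambda>(x, t). H x t))"

text \<open>A classical solution \<open>(v,\<rho>,\<phi>)\<close> on all of \<open>\<real>\<^sup>n \<times> [0,\<infinity>)\<close> that is of class \<open>C\<^sup>1\<close> up to \<open>t = 0\<close>.
  The momentum equation is written for each component \<open>i\<close>: row \<open>i\<close> of \<open>\<rho> v \<otimes> v\<close> is the vector
  field \<open>\<rho> v\<^sup>i v\<close>.\<close>

definition global_C1_solution ::
  "real \<Rightarrow> (real^'n::finite \<Rightarrow> real^'n) \<Rightarrow> (real^'n \<Rightarrow> real) \<Rightarrow>
   (real^'n \<Rightarrow> real \<Rightarrow> real^'n) \<Rightarrow> (real^'n \<Rightarrow> real \<Rightarrow> real) \<Rightarrow> (real^'n \<Rightarrow> real \<Rightarrow> real) \<Rightarrow> bool" where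
  "global_C1_solution k v\<^sub>0 \<rho>\<^sub>0 v \<rho> \<phi> \<longleftrightarrow>
     C1_on (\<lambda>(x, t). v x t) (UNIV \<times> {0..}) \<and>
     C1_on (\<lambda>(x, t). \<rho> x t) (UNIV \<times> {0..}) \<and>
     C2_in_space \<phi> \<and>
     (\<forall>x. \<forall>t\<ge>0. \<rho> x t \<ge> 0) \<and>
     (\<forall>x. \<forall>t\<ge>0.
        time_deriv (\<lambda>s. \<rho> x s) t + divergence (\<lambda>y. \<rho> y t *\<^sub>R v y t) x = 0) \<and>
     (\<forall>x. \<forall>t\<ge>0. \<forall>i.
        time_deriv (\<lambda>s. \<rho> x s * v x s $ i) t
          + divergence (\<lambda>y. (\<rho> y t * v y t $ i) *\<^sub>R v y t) x
        = - k * \<rho> x t * partial_deriv i (\<lambda>y. \<phi> y t) x) \<and>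
     (\<forall>x. \<forall>t\<ge>0. laplacian (\<lambda>y. \<phi> y t) x = \<rho> x t) \<and>
     (\<forall>x. v x 0 = v\<^sub>0 x) \<and>
     (\<forall>x. \<rho> x 0 = \<rho>\<^sub>0 x)"

text \<open>Condition at infinity: a particle path issuing from a point of positive density stays bounded
  on every bounded time interval on which it is defined.  It holds whenever \<open>v\<close> is bounded, or
  grows at most linearly in \<open>x\<close>, on each \<open>\<real>\<^sup>n \<times> [0,T]\<close>; in particular for \<open>H\<^sup>s\<close> solutions
  with \<open>s > n/2 + 1\<close>.  Some such condition is needed: \<open>\<Delta>\<phi> = \<rho>\<close> fixes \<open>\<phi>\<close> only up to a
  (time-dependent) harmonic function, and for \<open>n \<ge> 2\<close> a rapidly growing harmonic part can carry
  a blob of mass off to infinity before it collapses, leaving a vacuum and fields that are \<open>C\<^sup>1\<close>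
  for all times.\<close>

definition no_mass_escape ::
  "(real^'n::finite \<Rightarrow> real) \<Rightarrow> (real^'n \<Rightarrow> real \<Rightarrow> real^'n) \<Rightarrow> bool" where
  "no_mass_escape \<rho>\<^sub>0 v \<longleftrightarrow>
     (\<forall>a T X. \<rho>\<^sub>0 a > 0 \<longrightarrow> X 0 = a \<longrightarrow>
        (\<forall>t\<in>{0..<T}. (X has_vector_derivative v (X t) t) (at t within {0..<T})) \<longrightarrow>
        bounded (X ` {0..<T}))"

definition blowup_set ::
  "real \<Rightarrow> (real^'n::finite \<Rightarrow> real^'n) \<Rightarrow> (real^'n \<Rightarrow> real) \<Rightarrow> (real^'n) set" where
  "blowup_set k v\<^sub>0 \<rho>\<^sub>0 =
     {a. vorticity v\<^sub>0 a = 0 \<and>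
         - divergence v\<^sub>0 a \<ge> sqrt (2 * k * \<rho>\<^sub>0 a / 3) \<and> sqrt (2 * k * \<rho>\<^sub>0 a / 3) > 0}"

end

theory Submission
  imports Defs
begin

text \<open>
  The velocity gradient blows up along the particle path \<open>X\<close> that starts at a point \<open>a\<close> of the
  blow-up set. There the density is positive, the vorticity vanishes and the divergence is negative.

  Suppose the solution is \<open>C\<^sup>1\<close> for all times. Then \<open>X\<close> exists on every interval \<open>[0, T]\<close>: the
  velocity is locally Lipschitz, and paths carrying mass do not escape to infinity
  (\<open>global_path\<close>). By the continuity equation the density obeys \<open>\<rho>' = - \<rho> div v\<close> along \<open>X\<close>, so
  it stays positive there and, by compactness, in a tube around the path. In that tube the momentum
  equation can be divided by \<open>\<rho>\<close> and says that the material acceleration is \<open>- k \<nabla>\<phi>\<close>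
  (\<open>euler_poisson_pointwise\<close>). Consequently the matrix \<open>A\<close> of the spatial derivative of \<open>v\<close> satisfies
  the matrix Riccati equation \<open>A' = - k H - A\<^sup>2\<close> along \<open>X\<close>, where \<open>H\<close> is the Hessian of the
  potential. This is \<open>velocity_gradient_along_path\<close>, the heart of the proof: the differentiated
  equation has to be obtained for a velocity that is merely \<open>C\<^sup>1\<close>.

  The Hessian is symmetric, so the skew part of \<open>A\<close>, which is the vorticity, solves a linear
  homogeneous equation and remains zero (\<open>riccati_preserves_symmetry\<close>). For symmetric \<open>A\<close> the
  trace of \<open>A\<^sup>2\<close> is at least \<open>d\<^sup>2 / n\<close>, where \<open>d\<close>, the trace of \<open>A\<close>, is the divergence. The
  trace of \<open>H\<close> is \<open>\<Delta>\<phi> = \<rho>\<close>, so attraction only helps: \<open>d' \<le> - k \<rho> - d\<^sup>2 / n \<le> - d\<^sup>2 / n\<close>. Since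
  \<open>d\<close> is negative initially, it cannot stay finite up to the time \<open>- n / d 0\<close> (\<open>riccati_blowup\<close>).
\<close>

section \<open>Scalar differential inequalities on an interval\<close>

lemma le_if_derivative_nonneg:
  fixes f :: "real \<Rightarrow> real"
  assumes "\<And>t. t \<in> {0..T} \<Longrightarrow> (f has_vector_derivative f' t) (at t within {0..T})"
    and "\<And>t. t \<in> {0..T} \<Longrightarrow> 0 \<le> f' t" and t: "t \<in> {0..T}"
  shows "f 0 \<le> f t"
proof -
  have "(f has_derivative (\<lambda>h. h * f' s)) (at s within {0..t})" if "s \<in> {0..t}" for s
    using assms(1)[of s] that t
    by (auto simp: has_vector_derivative_def intro: has_derivative_subset)
  then obtain s where "s \<in> {0..t}" "f t - f 0 = (t - 0) * f' s"
    using mvt_very_simple[of 0 t f "\<lambda>s h. h * f' s"] t by auto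
  moreover have "0 \<le> t * f' s" using assms(2)[of s] t \<open>s \<in> {0..t}\<close> by simp
  ultimately show ?thesis by simp
qed

text \<open>Gronwall's argument: the squared norm, damped by \<open>exp (- 2 * L * t)\<close>, does not increase. It gives
  both the uniqueness of particle paths and the persistence of irrotationality.\<close>

lemma zero_if_derivative_linearly_bounded:
  fixes y :: "real \<Rightarrow> 'a::real_inner"
  assumes deriv: "\<And>t. t \<in> {0..T} \<Longrightarrow> (y has_vector_derivative y' t) (at t within {0..T})"
    and bound: "\<And>t. t \<in> {0..T} \<Longrightarrow> norm (y' t) \<le> L * norm (y t)"
    and "y 0 = 0" and t: "t \<in> {0..T}"
  shows "y t = 0"
proof -
  define u where "u s = - (exp (- (2 * L) * s) * (y s \<bullet> y s))" for s
  define u' where "u' s = exp (- (2 * L) * s) * (2 * L * (y s \<bullet> y s) - 2 * (y s \<bullet> y' s))" for s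
  have "u 0 \<le> u t"
  proof (rule le_if_derivative_nonneg[where f=u and f'=u' and T=T])
    fix s assume s: "s \<in> {0..T}"
    have [derivative_intros]: "(y has_derivative (\<lambda>h. h *\<^sub>R y' s)) (at s within {0..T})"
      using deriv[OF s] by (simp add: has_vector_derivative_def)
    have "(u has_derivative (\<lambda>h. h * u' s)) (at s within {0..T})"
      unfolding u_def[abs_def] u'_def
      by (auto intro!: derivative_eq_intros simp: inner_commute algebra_simps)
    then show "(u has_vector_derivative u' s) (at s within {0..T})"
      by (simp add: has_vector_derivative_def)
    have "y s \<bullet> y' s \<le> norm (y s) * norm (y' s)" by (rule norm_cauchy_schwarz)
    also have "\<dots> \<le> norm (y s) * (L * norm (y s))"
      using bound[OF s] by (intro mult_left_mono) auto
    also have "\<dots> = L * (y s \<bullet> y s)" by (simp add: dot_square_norm power2_eq_square)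
    finally show "0 \<le> u' s" by (simp add: u'_def)
  qed (rule t)
  then have "y t \<bullet> y t \<le> 0" using \<open>y 0 = 0\<close> by (simp add: u_def mult_le_0_iff)
  then show ?thesis using inner_ge_zero[of "y t"] by simp
qed

text \<open>For the density along a path, where \<open>d\<close> is the divergence. Nonnegativity is known
  beforehand, so a monotonicity argument replaces the explicit solution.\<close>

lemma positive_if_linear_ode:
  fixes q d :: "real \<Rightarrow> real"
  assumes q: "\<And>t. t \<in> {0..T} \<Longrightarrow> (q has_vector_derivative - q t * d t) (at t within {0..T})"
    and q0: "q 0 > 0" and nonneg: "\<And>t. t \<in> {0..T} \<Longrightarrow> 0 \<le> q t"
    and d: "continuous_on {0..T} d" and t: "t \<in> {0..T}"
  shows "q t > 0"
proof -
  have "bounded (d ` {0..T})"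
    by (intro compact_imp_bounded compact_continuous_image d) auto
  then obtain c where c: "\<forall>t\<in>{0..T}. norm (d t) \<le> c" unfolding bounded_iff by blast
  \<comment> \<open>With \<open>c\<close> an upper bound of \<open>d\<close>, \<open>exp (c * t) * q t\<close> has the derivative
     \<open>exp (c * t) * (q t * (c - d t)) \<ge> 0\<close>.\<close>
  have "exp (c * 0) * q 0 \<le> exp (c * t) * q t"
  proof (rule le_if_derivative_nonneg[where f="\<lambda>s. exp (c * s) * q s" and T=T
        and f'="\<lambda>s. exp (c * s) * (q s * (c - d s))"])
    fix s assume s: "s \<in> {0..T}"
    have [derivative_intros]: "(q has_real_derivative - q s * d s) (at s within {0..T})"
      using q[OF s] by (simp add: has_real_derivative_iff_has_vector_derivative)
    have "((\<lambda>s. exp (c * s) * q s) has_real_derivative exp (c * s) * (q s * (c - d s))) (at s within {0..T})"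
      by (auto intro!: derivative_eq_intros simp: algebra_simps)
    then show "((\<lambda>s. exp (c * s) * q s) has_vector_derivative exp (c * s) * (q s * (c - d s))) (at s within {0..T})"
      by (simp add: has_real_derivative_iff_has_vector_derivative)
    have "d s \<le> c" using c s by force
    then show "0 \<le> exp (c * s) * (q s * (c - d s))" using nonneg[OF s] by simp
  qed (rule t)
  then have "0 < exp (c * t) * q t" using q0 by simp
  then show ?thesis by (simp add: zero_less_mult_iff)
qed

text \<open>The reciprocal of a negative solution of \<open>d' \<le> - d\<^sup>2 / n\<close> increases at rate at least \<open>1 / n\<close>
  and would reach \<open>0\<close> by the time \<open>- n / d 0\<close>.\<close>

lemma riccati_blowup:
  fixes d :: "real \<Rightarrow> real"
  assumes "n > 0" "d 0 < 0" and T: "T = - n / d 0"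
    and deriv: "\<And>t. t \<in> {0..T} \<Longrightarrow> (d has_vector_derivative d' t) (at t within {0..T})"
    and le: "\<And>t. t \<in> {0..T} \<Longrightarrow> d' t \<le> - (d t)\<^sup>2 / n"
  shows False
proof -
  have T0: "T \<ge> 0" using assms(1,2) by (simp add: T divide_nonneg_neg)
  have neg: "d t < 0" if t: "t \<in> {0..T}" for t
  proof -
    have "- d 0 \<le> - d t"
    proof (rule le_if_derivative_nonneg[where f="\<lambda>s. - d s" and f'="\<lambda>s. - d' s" and T=T])
      show "((\<lambda>s. - d s) has_vector_derivative - d' s) (at s within {0..T})" if "s \<in> {0..T}" for s
        using deriv[OF that] by (auto intro!: derivative_eq_intros)
      show "0 \<le> - d' s" if "s \<in> {0..T}" for s
      proof -
        have "- (d s)\<^sup>2 / n \<le> 0" using \<open>n > 0\<close> by simp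
        then show ?thesis using le[OF that] by linarith
      qed
    qed (rule t)
    then show ?thesis using \<open>d 0 < 0\<close> by simp
  qed
  \<comment> \<open>At time \<open>T\<close> this says \<open>inverse (d T) \<ge> inverse (d 0) + T / n = 0\<close>.\<close>
  have "inverse (d 0) - 0 / n \<le> inverse (d T) - T / n"
  proof (rule le_if_derivative_nonneg[where f="\<lambda>s. inverse (d s) - s / n"
        and f'="\<lambda>s. - d' s / (d s)\<^sup>2 - 1 / n" and T=T])
    fix s assume s: "s \<in> {0..T}"
    have "(d has_real_derivative d' s) (at s within {0..T})"
      using deriv[OF s] by (simp add: has_real_derivative_iff_has_vector_derivative)
    then have "((\<lambda>s. inverse (d s) - s / n) has_real_derivative - d' s / (d s)\<^sup>2 - 1 / n) (at s within {0..T})"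
      using neg[OF s] \<open>n > 0\<close> by (auto intro!: derivative_eq_intros simp: power2_eq_square field_simps)
    then show "((\<lambda>s. inverse (d s) - s / n) has_vector_derivative - d' s / (d s)\<^sup>2 - 1 / n) (at s within {0..T})"
      by (simp add: has_real_derivative_iff_has_vector_derivative)
    show "0 \<le> - d' s / (d s)\<^sup>2 - 1 / n"
      using le[OF s] neg[OF s] \<open>n > 0\<close> by (simp add: field_simps)
  qed (use T0 in auto)
  moreover have "inverse (d T) < 0" using neg[of T] T0 by simp
  moreover have "T / n = - inverse (d 0)" using assms(1,2) by (simp add: T field_simps)
  ultimately show False by simp
qed

section \<open>Existence of particle paths\<close>

text \<open>Banach's fixed point theorem for the integral equation. In the norm weighted by
  \<open>exp (- K * t)\<close> with \<open>K > L\<close> the Picard map contracts on an interval of any length, so no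
  concatenation of short-time solutions is needed.\<close>

lemma picard_lipschitz:
  fixes F :: "real \<Rightarrow> 'a::banach \<Rightarrow> 'a"
  assumes cont: "continuous_on ({0..T} \<times> UNIV) (\<lambda>(t, x). F t x)"
    and lip: "\<And>t x y. t \<in> {0..T} \<Longrightarrow> norm (F t x - F t y) \<le> L * norm (x - y)"
    and "0 \<le> L" "0 \<le> T"
  obtains X where "X 0 = a"
    "\<And>t. t \<in> {0..T} \<Longrightarrow> (X has_vector_derivative F t (X t)) (at t within {0..T})"
proof -
  \<comment> \<open>Any rate above \<open>L\<close> works: the contraction factor will be \<open>L / K\<close>.\<close>
  define K where "K = L + 1"
  have K: "0 < K" "L < K" using \<open>0 \<le> L\<close> by (auto simp: K_def)
  \<comment> \<open>Bounded continuous functions live on all of \<open>\<real>\<close>; clamping time makes them see \<open>{0..T}\<close> only.\<close>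
  define c where "c t = max 0 (min t T)" for t
  have c: "c t \<in> {0..T}" and c_eq: "t \<in> {0..T} \<Longrightarrow> c t = t" for t
    using \<open>0 \<le> T\<close> by (auto simp: c_def)
  \<comment> \<open>The unknown is \<open>u t = exp (- K * t) *\<^sub>R X t\<close>, so that its sup norm is the weighted norm of \<open>X\<close>.\<close>
  define f where "f u s = F s (exp (K * s) *\<^sub>R apply_bcontfun u s)" for u s
  have f_cont: "continuous_on {0..T} (f u)" for u
    unfolding f_def
    by (rule continuous_on_compose2[OF cont, where f="\<lambda>s. (s, exp (K * s) *\<^sub>R apply_bcontfun u s)", simplified])
       (auto intro!: continuous_intros)
  have f_int: "f u integrable_on {0..t}" if "t \<in> {0..T}" for u t
    using that by (intro integrable_continuous_real continuous_on_subset[OF f_cont]) auto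
  define G where "G u t = exp (- K * t) *\<^sub>R (a + integral {0..t} (f u))" for u t
  have G_cont: "continuous_on {0..T} (G u)" for u
    unfolding G_def
    using indefinite_integral_continuous_1[OF f_int[of T u]] \<open>0 \<le> T\<close>
    by (auto intro!: continuous_intros)
  have "(\<lambda>t. G u (c t)) \<in> bcontfun" for u
  proof -
    have "continuous_on UNIV (\<lambda>t. G u (c t))"
      using c by (intro continuous_on_compose2[OF G_cont]) (auto simp: c_def[abs_def] intro!: continuous_intros)
    moreover have "bounded (range (\<lambda>t. G u (c t)))"
      using c by (auto intro!: bounded_subset[OF compact_imp_bounded[OF compact_continuous_image[OF G_cont]]])
    ultimately show ?thesis by (simp add: bcontfun_def)
  qed
  then have app: "apply_bcontfun (Bcontfun (\<lambda>t. G u (c t))) t = G u (c t)" for u t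
    by (simp add: Bcontfun_inverse)
  have contr: "dist (Bcontfun (\<lambda>t. G u (c t))) (Bcontfun (\<lambda>t. G w (c t))) \<le> L / K * dist u w" for u w
  proof (rule dist_bound, unfold app)
    fix t' define t where "t = c t'"
    have t: "t \<in> {0..T}" using c by (simp add: t_def)
    have I: "((\<lambda>s. L * (exp (K * s) * dist u w)) has_integral (L / K * exp (K * t) * dist u w - L / K * exp (K * 0) * dist u w)) {0..t}"
      using t K
      by (intro fundamental_theorem_of_calculus)
         (auto intro!: derivative_eq_intros simp flip: has_real_derivative_iff_has_vector_derivative)
    have "norm (integral {0..t} (f u) - integral {0..t} (f w)) = norm (integral {0..t} (\<lambda>s. f u s - f w s))"
      using t by (simp add: integral_diff f_int)
    also have "\<dots> \<le> integral {0..t} (\<lambda>s. L * (exp (K * s) * dist u w))"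
    proof (rule integral_norm_bound_integral)
      show "(\<lambda>s. f u s - f w s) integrable_on {0..t}" using t by (intro integrable_diff f_int)
      show "(\<lambda>s. L * (exp (K * s) * dist u w)) integrable_on {0..t}" using I by blast
      fix s assume s: "s \<in> {0..t}"
      then have "norm (f u s - f w s) \<le> L * norm (exp (K * s) *\<^sub>R apply_bcontfun u s - exp (K * s) *\<^sub>R apply_bcontfun w s)"
        unfolding f_def using t by (intro lip) auto
      also have "\<dots> = L * (exp (K * s) * dist (apply_bcontfun u s) (apply_bcontfun w s))"
        by (simp add: dist_norm flip: scaleR_diff_right)
      also have "\<dots> \<le> L * (exp (K * s) * dist u w)"
        using \<open>0 \<le> L\<close> by (intro mult_left_mono dist_bounded) auto
      finally show "norm (f u s - f w s) \<le> L * (exp (K * s) * dist u w)" .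
    qed
    also have "\<dots> = L / K * exp (K * t) * dist u w - L / K * exp (K * 0) * dist u w"
      using I by (rule integral_unique)
    also have "\<dots> \<le> L / K * exp (K * t) * dist u w"
      using K \<open>0 \<le> L\<close> by (simp add: divide_nonneg_pos)
    finally have "exp (- K * t) * norm (integral {0..t} (f u) - integral {0..t} (f w))
       \<le> exp (- K * t) * (L / K * exp (K * t) * dist u w)"
      by (intro mult_left_mono) auto
    also have "\<dots> = L / K * dist u w" by (simp add: exp_minus)
    finally show "dist (G u (c t')) (G w (c t')) \<le> L / K * dist u w"
      unfolding t_def[symmetric] by (simp add: G_def dist_norm flip: scaleR_diff_right)
  qed
  obtain u where u: "Bcontfun (\<lambda>t. G u (c t)) = u"
    using banach_fix_type[of "L / K" "\<lambda>u. Bcontfun (\<lambda>t. G u (c t))"] contr K \<open>0 \<le> L\<close> by auto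
  define X where "X t = a + integral {0..t} (f u)" for t
  have X: "exp (K * t) *\<^sub>R apply_bcontfun u t = X t" if "t \<in> {0..T}" for t
    using app[of u t] u c_eq[OF that] by (simp add: G_def X_def exp_minus)
  show thesis
  proof
    show "X 0 = a" by (simp add: X_def)
    fix t assume t: "t \<in> {0..T}"
    have "(X has_vector_derivative f u t) (at t within {0..T})"
      unfolding X_def[abs_def]
      using integral_has_vector_derivative[OF f_cont t, of u] by (auto intro!: derivative_eq_intros)
    then show "(X has_vector_derivative F t (X t)) (at t within {0..T})"
      by (simp add: f_def X[OF t])
  qed
qed

lemma at_within_Icc_less: "t < (T::real) \<Longrightarrow> at t within {0..T} = at t within {0..}"
  by (rule at_within_nhd[of t "{..<T}"]) auto

text \<open>A field that is only locally Lipschitz still has a path for all times if its paths cannot run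
  off to infinity in finite time. Otherwise let \<open>S\<close> be the supremum of the existence times.
  The path on \<open>[0, S)\<close> is bounded, so it is also a path of a truncated, globally Lipschitz field,
  whose solution goes on past \<open>S\<close> and stays, for a while, where the truncation changes nothing.\<close>

lemma global_path:
  fixes v :: "'a::euclidean_space \<Rightarrow> real \<Rightarrow> 'a"
  assumes cont: "continuous_on (UNIV \<times> {0..}) (\<lambda>(x, t). v x t)"
    and lip: "\<And>R T. \<exists>L\<ge>0. \<forall>t\<in>{0..T}. \<forall>x\<in>cball 0 R. \<forall>y\<in>cball 0 R. norm (v x t - v y t) \<le> L * norm (x - y)"
    and bdd: "\<And>T X. X 0 = a \<Longrightarrow>
        (\<And>t. t \<in> {0..<T} \<Longrightarrow> (X has_vector_derivative v (X t) t) (at t within {0..<T})) \<Longrightarrow>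
        bounded (X ` {0..<T})"
  obtains X where "X 0 = a"
    "\<And>t. t \<in> {0..T} \<Longrightarrow> (X has_vector_derivative v (X t) t) (at t within {0..T})"
proof -
  \<comment> \<open>Half-open intervals: they can be restricted, glued and extended without touching the right
     end, and the derivative within \<open>{0..}\<close> does not depend on the interval.\<close>
  define sol where "sol T X \<longleftrightarrow> X 0 = a \<and>
      (\<forall>t. 0 \<le> t \<longrightarrow> t < T \<longrightarrow> (X has_vector_derivative v (X t) t) (at t within {0..}))" for T X
  have sol_sub: "sol S X" if "sol T X" "S \<le> T" for S T X
    using that by (auto simp: sol_def)
  have unique: "X t = Y t" if "sol T X" "sol T Y" "0 \<le> t" "t < T" for X Y T t
  proof -
    have dX: "(X has_vector_derivative v (X s) s) (at s within {0..t})" 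
     and dY: "(Y has_vector_derivative v (Y s) s) (at s within {0..t})" if "s \<in> {0..t}" for s
      using \<open>sol T X\<close> \<open>sol T Y\<close> \<open>t < T\<close> that
      by (auto simp: sol_def intro!: has_vector_derivative_within_subset[of _ _ _ "{0..}" "{0..t}"])
    have "compact (X ` {0..t} \<union> Y ` {0..t})"
      using continuous_on_vector_derivative[OF dX] continuous_on_vector_derivative[OF dY]
      by (intro compact_Un compact_continuous_image) auto
    then have "bounded (X ` {0..t} \<union> Y ` {0..t})" by (rule compact_imp_bounded)
    then obtain R where R: "\<forall>x \<in> X ` {0..t} \<union> Y ` {0..t}. norm x \<le> R"
      unfolding bounded_iff by blast
    obtain L where L: "\<forall>s\<in>{0..t}. \<forall>x\<in>cball 0 R. \<forall>y\<in>cball 0 R. norm (v x s - v y s) \<le> L * norm (x - y)"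
      using lip by blast
    have "X t - Y t = 0"
    proof (rule zero_if_derivative_linearly_bounded[where T=t and L=L and t=t])
      show "((\<lambda>s. X s - Y s) has_vector_derivative v (X s) s - v (Y s) s) (at s within {0..t})"
        if "s \<in> {0..t}" for s using dX[OF that] dY[OF that] by (rule has_vector_derivative_diff)
      show "norm (v (X s) s - v (Y s) s) \<le> L * norm (X s - Y s)" if "s \<in> {0..t}" for s
        using L R that by auto
    qed (use that in \<open>auto simp: sol_def\<close>)
    then show ?thesis by simp
  qed
  have "\<exists>X. sol T X" for T
  proof (rule ccontr)
    assume T: "\<nexists>X. sol T X"
    define A where "A = {S. \<exists>X. sol S X}"
    have A0: "0 \<in> A" by (auto simp: A_def sol_def intro!: exI[of _ "\<lambda>_. a"])
    have A_less: "S < T" if "S \<in> A" for S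
      using that T sol_sub[of S _ T] by (force simp: A_def not_less)
    then have bddA: "bdd_above A" by (auto intro!: bdd_aboveI[of _ T] less_imp_le)
    define S where "S = Sup A"
    have S0: "0 \<le> S" unfolding S_def using A0 bddA by (rule cSup_upper)
    define Z where "Z r = (SOME X. sol r X)" for r
    have Z: "sol r (Z r)" if "r \<in> A" for r
      using that unfolding A_def Z_def mem_Collect_eq by (rule someI_ex)
    have ex: "\<exists>r\<in>A. t < r" if "t < S" for t
      using that less_cSup_iff[of A t] A0 bddA unfolding S_def by auto
    \<comment> \<open>By uniqueness all solutions that reach past \<open>t\<close> agree there, so any of them may give \<open>X t\<close>.\<close>
    define X where "X t = Z (SOME r. r \<in> A \<and> t < r) t" for t
    have X_eq: "X t = Y t" if "sol r Y" "0 \<le> t" "t < r" for r t Y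
    proof -
      define q where "q = (SOME r. r \<in> A \<and> t < r)"
      have "r \<in> A" using that by (auto simp: A_def)
      then have q: "q \<in> A" "t < q" unfolding q_def using someI[of "\<lambda>r. r \<in> A \<and> t < r" r] that by auto
      show ?thesis unfolding X_def q_def[symmetric]
        using sol_sub[OF Z[OF q(1)], of "min q r"] sol_sub[OF \<open>sol r Y\<close>, of "min q r"] that q
        by (intro unique[of "min q r"]) auto
    qed
    have dX: "(X has_vector_derivative v (X t) t) (at t within {0..})" if t: "0 \<le> t" "t < S" for t
    proof -
      obtain r where r: "r \<in> A" "t < r" using ex t by blast
      have "(Z r has_vector_derivative v (Z r t) t) (at t within {0..})"
        using Z[OF r(1)] t r by (auto simp: sol_def)
      then have "(X has_vector_derivative v (Z r t) t) (at t within {0..})"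
        by (rule has_vector_derivative_transform_within[of _ _ _ _ "r - t"])
           (use r t X_eq[OF Z[OF r(1)]] in \<open>auto simp: dist_real_def\<close>)
      then show ?thesis using X_eq[OF Z[OF r(1)]] r t by simp
    qed
    \<comment> \<open>If \<open>S = 0\<close>, nothing fixes \<open>X 0\<close>; the correction costs nothing in the other case.\<close>
    define X0 where "X0 = X(0 := a)"
    have X0: "X0 t = X t" if "0 \<le> t" "t < S" for t
      using ex[OF that(2)] X_eq[OF Z] that Z by (auto simp: X0_def sol_def)
    have dX0: "(X0 has_vector_derivative v (X0 t) t) (at t within {0..})" if t: "0 \<le> t" "t < S" for t
      using dX[OF t] t X0[OF t]
      by (auto intro!: has_vector_derivative_transform_within[of X _ t "{0..}" "S - t" X0] simp: X0 dist_real_def)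
    have "bounded (X0 ` {0..<S})"
    proof (rule bdd)
      show "X0 0 = a" by (simp add: X0_def)
      show "(X0 has_vector_derivative v (X0 t) t) (at t within {0..<S})" if "t \<in> {0..<S}" for t
        using that by (intro has_vector_derivative_within_subset[OF dX0]) auto
    qed
    then have "bounded (insert a (X0 ` {0..<S}))" by simp
    then obtain M where M: "norm a \<le> M" "\<And>t. t \<in> {0..<S} \<Longrightarrow> norm (X0 t) \<le> M"
      unfolding bounded_iff by auto
    have M0: "0 \<le> M" using M(1) norm_ge_zero order_trans by blast
    \<comment> \<open>Composing the field with the projection onto a ball one unit larger than the bound \<open>M\<close>
       makes it globally Lipschitz and leaves it unchanged near the path.\<close>
    define p where "p = closest_point (cball (0::'a) (M + 1))"
    have p_in: "p x \<in> cball 0 (M + 1)" for x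
      unfolding p_def using M0 by (intro closest_point_in_set) auto
    have p_id: "p x = x" if "norm x \<le> M + 1" for x
      unfolding p_def using that by (intro closest_point_self) auto
    have p_lip: "norm (p x - p y) \<le> norm (x - y)" for x y
      unfolding p_def using closest_point_lipschitz[of "cball (0::'a) (M + 1)" x y] M0 by (auto simp: dist_norm)
    have p_cont: "continuous_on UNIV p"
      unfolding p_def using M0 by (intro continuous_on_closest_point) auto
    obtain L where "L \<ge> 0" and L: "\<forall>t\<in>{0..S+1}. \<forall>x\<in>cball 0 (M+1). \<forall>y\<in>cball 0 (M+1). norm (v x t - v y t) \<le> L * norm (x - y)"
      using lip by blast
    have plip: "norm (v (p x) t - v (p y) t) \<le> L * norm (x - y)" if "t \<in> {0..S+1}" for t x y
      using L p_in that \<open>L \<ge> 0\<close> mult_left_mono[OF p_lip \<open>L \<ge> 0\<close>, of x y] order_trans by blast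
    have "continuous_on ({0..S+1} \<times> UNIV) (\<lambda>(t, x). v (p x) t)"
      unfolding split_beta
      by (rule continuous_on_compose2[OF cont, where f="\<lambda>z. (p (snd z), fst z)", simplified])
         (auto intro!: continuous_intros continuous_on_compose2[OF p_cont])
    then obtain Y where Y0: "Y 0 = a"
      and dY: "\<And>t. t \<in> {0..S+1} \<Longrightarrow> (Y has_vector_derivative v (p (Y t)) t) (at t within {0..S+1})"
      using picard_lipschitz[of "S+1" "\<lambda>t x. v (p x) t" L a] plip \<open>L \<ge> 0\<close> S0 by auto
    have XY: "X0 t = Y t" if t: "0 \<le> t" "t < S" for t
    proof -
      have "X0 t - Y t = 0"
      proof (rule zero_if_derivative_linearly_bounded[where T=t and L=L and t=t])
        show "((\<lambda>s. X0 s - Y s) has_vector_derivative v (p (X0 s)) s - v (p (Y s)) s) (at s within {0..t})"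
          if s: "s \<in> {0..t}" for s
        proof (rule has_vector_derivative_diff)
          show "(X0 has_vector_derivative v (p (X0 s)) s) (at s within {0..t})"
            using dX0[of s] M(2)[of s] p_id[of "X0 s"] s t
            by (auto intro: has_vector_derivative_within_subset)
          show "(Y has_vector_derivative v (p (Y s)) s) (at s within {0..t})"
            using dY[of s] s t by (auto intro: has_vector_derivative_within_subset)
        qed
        show "norm (v (p (X0 s)) s - v (p (Y s)) s) \<le> L * norm (X0 s - Y s)" if "s \<in> {0..t}" for s
          using that t by (intro plip) auto
      qed (use t Y0 in \<open>auto simp: X0_def\<close>)
      then show ?thesis by simp
    qed
    have Y_cont: "continuous_on {0..S+1} Y"
      using dY by (rule continuous_on_vector_derivative)
    have YM: "norm (Y t) \<le> M" if "0 \<le> t" "t < S" for t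
      using XY[OF that] M(2)[of t] that by auto
    have YS: "norm (Y S) \<le> M"
    proof (cases "S = 0")
      case True then show ?thesis using Y0 M(1) by simp
    next
      case False
      have "norm (Y t) \<le> M" if "t \<in> {0..S}" for t
        by (rule continuous_le_on_closure[of "{0..<S}" "\<lambda>t. norm (Y t)"])
           (use False S0 that YM in \<open>auto intro!: continuous_intros continuous_on_subset[OF Y_cont]\<close>)
      then show ?thesis using S0 by auto
    qed
    obtain d where d: "d > 0" "\<And>t. t \<in> {0..S+1} \<Longrightarrow> dist t S < d \<Longrightarrow> dist (Y t) (Y S) < 1"
      using Y_cont[unfolded continuous_on_iff, rule_format, of S 1] S0 by auto
    define e where "e = min d 1"
    have YM1: "norm (Y t) \<le> M + 1" if "0 \<le> t" "t < S + e" for t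
    proof (cases "t < S")
      case True then show ?thesis using YM[of t] that by auto
    next
      case False
      then have "dist (Y t) (Y S) < 1" using that by (intro d) (auto simp: e_def dist_real_def)
      then show ?thesis using YS norm_triangle_sub[of "Y t" "Y S"] by (auto simp: dist_norm)
    qed
    have "sol (S + e) Y"
      unfolding sol_def
    proof (intro conjI allI impI)
      fix t assume t: "0 \<le> t" "t < S + e"
      then have "t < S + 1" by (auto simp: e_def)
      then show "(Y has_vector_derivative v (Y t) t) (at t within {0..})"
        using dY[of t] t p_id[OF YM1[OF t]] at_within_Icc_less[of t "S+1"] by auto
    qed (rule Y0)
    then have "S + e \<in> A" by (auto simp: A_def)
    then have "S + e \<le> S" unfolding S_def using bddA by (intro cSup_upper)
    then show False using d by (auto simp: e_def)
  qed
  then obtain X where "sol (T + 1) X" by blast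
  show thesis
  proof (rule that)
    show "X 0 = a" using \<open>sol (T + 1) X\<close> by (simp add: sol_def)
    show "(X has_vector_derivative v (X t) t) (at t within {0..T})" if "t \<in> {0..T}" for t
      using \<open>sol (T + 1) X\<close> that
      by (intro has_vector_derivative_within_subset[of X _ t "{0..}" "{0..T}"]) (auto simp: sol_def)
  qed
qed

section \<open>Derivatives in space and time\<close>

lemma has_derivative_spatial_slice:
  assumes "(f has_derivative f') (at (x, t) within UNIV \<times> {0..})" "0 \<le> t"
  shows "((\<lambda>y. f (y, t)) has_derivative (\<lambda>h. f' (h, 0))) (at x)"
proof (rule has_derivative_in_compose[where f="\<lambda>y. (y, t)"])
  show "((\<lambda>y. (y, t)) has_derivative (\<lambda>h. (h, 0))) (at x)"
    by (auto intro!: derivative_eq_intros)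
  show "(f has_derivative f') (at (x, t) within range (\<lambda>y. (y, t)))"
    using assms by (auto intro: has_derivative_subset)
qed

lemma has_vector_derivative_along_path:
  assumes f: "(f has_derivative f') (at (X t, t) within UNIV \<times> {0..})"
    and X: "(X has_vector_derivative X') (at t within S)" and S: "S \<subseteq> {0..}"
  shows "((\<lambda>s. f (X s, s)) has_vector_derivative f' (X', 1)) (at t within S)"
proof -
  interpret f': bounded_linear f' using f by (rule has_derivative_bounded_linear)
  have "((\<lambda>s. (X s, s)) has_derivative (\<lambda>h. (h *\<^sub>R X', h))) (at t within S)"
    using X by (auto simp: has_vector_derivative_def intro!: derivative_eq_intros)
  moreover have "(f has_derivative f') (at (X t, t) within (\<lambda>s. (X s, s)) ` S)"
    using f S by (auto intro: has_derivative_subset)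
  ultimately have "((\<lambda>s. f (X s, s)) has_derivative (\<lambda>h. f' (h *\<^sub>R X', h))) (at t within S)"
    by (rule has_derivative_in_compose)
  moreover have "f' (h *\<^sub>R X', h) = h *\<^sub>R f' (X', 1)" for h
    by (simp flip: f'.scaleR)
  ultimately show ?thesis by (simp add: has_vector_derivative_def)
qed

text \<open>Mean value inequality on a convex compact set, where the derivative is bounded.\<close>

lemma C1_lipschitz_on_balls:
  fixes f :: "'a::euclidean_space \<times> real \<Rightarrow> 'b::real_normed_vector"
  assumes D: "\<And>z. z \<in> UNIV \<times> {0..} \<Longrightarrow> (f has_derivative blinfun_apply (D z)) (at z within UNIV \<times> {0..})"
    and D_cont: "continuous_on (UNIV \<times> {0..}) D"
  shows "\<exists>L\<ge>0. \<forall>t\<in>{0..T}. \<forall>x\<in>cball 0 R. \<forall>y\<in>cball 0 R. norm (f (x, t) - f (y, t)) \<le> L * norm (x - y)"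
proof -
  have "compact (cball (0::'a) R \<times> {0..T})" by (intro compact_Times) auto
  then have "bounded (D ` (cball 0 R \<times> {0..T}))"
    by (intro compact_imp_bounded compact_continuous_image continuous_on_subset[OF D_cont]) auto
  then obtain L where L: "L > 0" "\<forall>z \<in> cball 0 R \<times> {0..T}. norm (D z) \<le> L"
    unfolding bounded_pos by blast
  have "norm (f (x, t) - f (y, t)) \<le> L * norm (x - y)"
    if t: "t \<in> {0..T}" and xy: "x \<in> cball 0 R" "y \<in> cball 0 R" for t x y
  proof (rule differentiable_bound[where S="cball 0 R" and f="\<lambda>x. f (x, t)" and f'="\<lambda>x h. D (x, t) (h, 0)"])
    fix x assume x: "x \<in> cball (0::'a) R"
    show "((\<lambda>x. f (x, t)) has_derivative (\<lambda>h. D (x, t) (h, 0))) (at x within cball 0 R)"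
      using has_derivative_spatial_slice[OF D, of x t] t by (auto intro: has_derivative_at_withinI)
    have "norm (D (x, t) (h, 0)) \<le> L * norm h" for h
    proof -
      have "norm (D (x, t) (h, 0)) \<le> norm (D (x, t)) * norm (h, 0::real)" by (rule norm_blinfun)
      also have "\<dots> \<le> L * norm (h, 0::real)" using L x t by (intro mult_right_mono) auto
      finally show ?thesis by (simp add: norm_Pair)
    qed
    then show "onorm (\<lambda>h. D (x, t) (h, 0)) \<le> L" by (rule onorm_le)
  qed (use xy in auto)
  then show ?thesis using L(1) by (intro exI[of _ L]) auto
qed

lemma has_derivative_nth:
  "(f has_derivative f') F \<Longrightarrow> ((\<lambda>x. f x $ i) has_derivative (\<lambda>h. f' h $ i)) F"
  by (rule bounded_linear.has_derivative[OF bounded_linear_vec_nth])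

lemma has_vector_derivative_vecI:
  fixes f :: "real \<Rightarrow> ('a::euclidean_space)^'n"
  assumes "\<And>i. ((\<lambda>t. f t $ i) has_vector_derivative f' $ i) (at t within S)"
  shows "(f has_vector_derivative f') (at t within S)"
  unfolding has_vector_derivative_def has_derivative_componentwise_within[of f]
proof
  fix b :: "'a^'n" assume "b \<in> Basis"
  then obtain i c where b: "b = axis i c" "c \<in> Basis" by (auto simp: Basis_vec_def)
  have "((\<lambda>t. f t $ i \<bullet> c) has_derivative (\<lambda>h. (h *\<^sub>R f' $ i) \<bullet> c)) (at t within S)"
    using has_derivative_inner_left[OF assms[of i, unfolded has_vector_derivative_def], of c] by simp
  then show "((\<lambda>t. f t \<bullet> b) has_derivative (\<lambda>h. (h *\<^sub>R f') \<bullet> b)) (at t within S)"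
    by (simp add: b inner_axis)
qed

lemma partial_deriv_eq:
  assumes "(f has_derivative f') (at x)"
  shows "partial_deriv i f x = f' (axis i 1)"
proof -
  interpret f': bounded_linear f' using assms by (rule has_derivative_bounded_linear)
  have "((\<lambda>s. f (x + s *\<^sub>R axis i 1)) has_derivative (\<lambda>h. f' (h *\<^sub>R axis i 1))) (at 0)"
    using assms by (intro has_derivative_compose[where f="\<lambda>s. x + s *\<^sub>R axis i 1" and g=f])
      (auto intro!: derivative_eq_intros)
  then have "((\<lambda>s. f (x + s *\<^sub>R axis i 1)) has_field_derivative f' (axis i 1)) (at 0)"
    by (simp add: has_field_derivative_def f'.scaleR mult_commute_abs)
  then show ?thesis unfolding partial_deriv_def by (rule DERIV_imp_deriv)
qed

lemma divergence_eq:
  assumes "(w has_derivative w') (at x)"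
  shows "divergence w x = (\<Sum>i\<in>UNIV. w' (axis i 1) $ i)"
  unfolding divergence_def using partial_deriv_eq[OF has_derivative_nth[OF assms]] by simp

text \<open>The product rule \<open>div (f w) = \<nabla>f \<bullet> w + f div w\<close>, which turns both conservation laws into
  statements about derivatives along particle paths.\<close>

lemma divergence_scaleR:
  assumes f: "(f has_derivative f') (at x)" and w: "(w has_derivative w') (at x)"
  shows "divergence (\<lambda>y. f y *\<^sub>R w y) x = f' (w x) + f x * divergence w x"
proof -
  interpret f': bounded_linear f' using f by (rule has_derivative_bounded_linear)
  have "f' (w x) = f' (\<Sum>i\<in>UNIV. w x $ i *\<^sub>R axis i 1)"
    by (simp add: basis_expansion flip: scalar_mult_eq_scaleR)
  also have "\<dots> = (\<Sum>i\<in>UNIV. w x $ i * f' (axis i 1))"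
    by (simp add: f'.sum f'.scaleR)
  finally show ?thesis
    by (simp add: divergence_eq[OF has_derivative_scaleR[OF f w]] divergence_eq[OF w]
        sum.distrib sum_distrib_left mult.commute add.commute)
qed

lemma time_deriv_eq:
  assumes "(f has_vector_derivative f') (at t within {0..})" "0 \<le> t"
  shows "time_deriv f t = f'"
proof -
  have "t islimpt {0..}"
    by (rule islimpt_subset[of _ "{0..t + 1}"]) (use \<open>0 \<le> t\<close> in auto)
  then have "at t within {0..} \<noteq> bot" by (simp add: trivial_limit_within)
  then show ?thesis unfolding time_deriv_def using assms(1) by (rule vector_derivative_within)
qed

text \<open>The symmetry of the Hessian of the potential is what keeps the flow irrotational.\<close>

lemma second_derivative_symmetric:
  fixes \<phi> :: "'a::real_inner \<Rightarrow> real"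
  assumes \<phi>: "\<And>y. (\<phi> has_derivative (\<lambda>h. g y \<bullet> h)) (at y)"
    and g: "(g has_derivative H) (at x)"
  shows "H a \<bullet> b = H b \<bullet> a"
proof -
  interpret H: bounded_linear H using g by (rule has_derivative_bounded_linear)
  define C where "C a b = norm a * (2 * norm a + norm b)" for a b :: 'a
  have *: "\<bar>H a \<bullet> b - H b \<bullet> a\<bar> \<le> e * (C a b + C b a)" if e: "e > 0" for e
  proof -
    obtain \<delta> where \<delta>: "\<delta> > 0" "\<And>y. norm (y - x) < \<delta> \<Longrightarrow> norm (g y - g x - H (y - x)) \<le> e * norm (y - x)"
      using g e unfolding has_derivative_at_alt by blast
    \<comment> \<open>A step for which all corners of the parallelogram stay within \<open>\<delta>\<close> of \<open>x\<close>.\<close>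
    define s where "s = \<delta> / (2 * (norm a + norm b + 1))"
    have N: "norm a + norm b + 1 > 0" by (simp add: add_nonneg_pos)
    then have s: "s > 0" using \<delta>(1) by (simp add: s_def)
    have "s * (norm a + norm b) \<le> s * (norm a + norm b + 1)" using s by simp
    also have "\<dots> = \<delta> / 2" using N by (simp add: s_def field_simps)
    also have "\<dots> < \<delta>" using \<delta>(1) by simp
    finally have small: "s * (norm a + norm b) < \<delta>" .
    \<comment> \<open>The second difference is symmetric in \<open>a\<close> and \<open>b\<close>, while the mean value theorem applied
       in direction \<open>a\<close> shows that it is \<open>s\<^sup>2 * (H b \<bullet> a)\<close> up to an error controlled by \<open>e\<close>.\<close>
    define \<Delta> where "\<Delta> a b = \<phi> (x + s *\<^sub>R a + s *\<^sub>R b) - \<phi> (x + s *\<^sub>R a) - (\<phi> (x + s *\<^sub>R b) - \<phi> x)" for a b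
    have est: "\<bar>\<Delta> a b - s\<^sup>2 * (H b \<bullet> a)\<bar> \<le> s\<^sup>2 * (e * C a b)"
      if small: "s * (norm a + norm b) < \<delta>" for a b
    proof -
      define f where "f r = \<phi> (x + (r * s) *\<^sub>R a + s *\<^sub>R b) - \<phi> (x + (r * s) *\<^sub>R a)" for r
      define f' where "f' r h = g (x + (r * s) *\<^sub>R a + s *\<^sub>R b) \<bullet> ((h * s) *\<^sub>R a)
          - g (x + (r * s) *\<^sub>R a) \<bullet> ((h * s) *\<^sub>R a)" for r h
      have "(f has_derivative f' r) (at r within {0..1})" for r
        unfolding f_def f'_def
        by (intro has_derivative_diff has_derivative_compose[OF _ \<phi>])
           (auto intro!: derivative_eq_intros)
      then have "\<exists>r\<in>{0..1}. f 1 - f 0 = f' r (1 - 0)"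
        by (intro mvt_very_simple) auto
      then obtain r where r: "r \<in> {0..1}" and "f 1 - f 0 = f' r (1 - 0)" ..
      moreover define p q where "p = x + (r * s) *\<^sub>R a + s *\<^sub>R b" and "q = x + (r * s) *\<^sub>R a"
      ultimately have 1: "f 1 - f 0 = s * ((g p - g q) \<bullet> a)"
        by (simp add: f'_def inner_diff_left right_diff_distrib)
      have ra: "norm ((r * s) *\<^sub>R a) \<le> s * norm a"
        using r s by (simp add: abs_mult mult.assoc mult_left_le_one_le)
      have p: "norm (p - x) \<le> s * (norm a + norm b)" and q: "norm (q - x) \<le> s * norm a"
        using ra norm_triangle_ineq[of "(r * s) *\<^sub>R a" "s *\<^sub>R b"] s
        by (auto simp: p_def q_def algebra_simps)
      have q': "norm (q - x) < \<delta>"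
      proof -
        have "0 \<le> s * norm b" using s by simp
        then show ?thesis using q small by (simp add: distrib_left)
      qed
      have Hpq: "H (p - x) - H (q - x) = s *\<^sub>R H b"
        by (simp add: p_def q_def flip: H.diff H.scaleR)
      have "norm (g p - g q - s *\<^sub>R H b) = norm ((g p - g x - H (p - x)) - (g q - g x - H (q - x)))"
        unfolding Hpq[symmetric] by (simp add: algebra_simps)
      also have "\<dots> \<le> e * norm (p - x) + e * norm (q - x)"
      proof (rule order_trans[OF norm_triangle_ineq4 add_mono])
        show "norm (g p - g x - H (p - x)) \<le> e * norm (p - x)"
          using p small by (intro \<delta>(2)) linarith
        show "norm (g q - g x - H (q - x)) \<le> e * norm (q - x)"
          using q' by (rule \<delta>(2))
      qed
      also have "\<dots> \<le> e * (s * (norm a + norm b)) + e * (s * norm a)"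
        using p q e by (intro add_mono mult_left_mono) auto
      finally have 2: "norm (g p - g q - s *\<^sub>R H b) \<le> e * s * (2 * norm a + norm b)"
        by (simp add: algebra_simps)
      have "\<Delta> a b = f 1 - f 0"
        by (simp add: \<Delta>_def f_def)
      then have "\<Delta> a b - s\<^sup>2 * (H b \<bullet> a) = s * ((g p - g q - s *\<^sub>R H b) \<bullet> a)"
        using 1 by (simp add: inner_diff_left power2_eq_square algebra_simps)
      then have "\<bar>\<Delta> a b - s\<^sup>2 * (H b \<bullet> a)\<bar> \<le> s * (norm (g p - g q - s *\<^sub>R H b) * norm a)"
        using s by (simp add: abs_mult Cauchy_Schwarz_ineq2)
      also have "\<dots> \<le> s * ((e * s * (2 * norm a + norm b)) * norm a)"
        using s 2 by (intro mult_left_mono mult_right_mono) auto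
      finally show ?thesis by (simp add: C_def power2_eq_square mult_ac)
    qed
    have "\<Delta> a b = \<Delta> b a" by (simp add: \<Delta>_def algebra_simps)
    then have "\<bar>s\<^sup>2 * (H a \<bullet> b - H b \<bullet> a)\<bar> \<le> s\<^sup>2 * (e * (C a b + C b a))"
      using est[of a b] est[of b a] small by (auto simp: algebra_simps abs_le_iff)
    then have "s\<^sup>2 * \<bar>H a \<bullet> b - H b \<bullet> a\<bar> \<le> s\<^sup>2 * (e * (C a b + C b a))"
      by (simp add: abs_mult)
    then show ?thesis using s by simp
  qed
  have "\<bar>H a \<bullet> b - H b \<bullet> a\<bar> \<le> 0"
  proof (rule field_le_epsilon)
    fix e :: real assume "e > 0"
    have "C a b + C b a \<ge> 0" by (simp add: C_def)
    then have "e / (C a b + C b a + 1) * (C a b + C b a) \<le> e"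
      using \<open>e > 0\<close> by (simp add: field_simps)
    moreover have "\<bar>H a \<bullet> b - H b \<bullet> a\<bar> \<le> e / (C a b + C b a + 1) * (C a b + C b a)"
      using \<open>e > 0\<close> \<open>C a b + C b a \<ge> 0\<close> by (intro *) (simp add: add_nonneg_pos)
    ultimately show "\<bar>H a \<bullet> b - H b \<bullet> a\<bar> \<le> 0 + e" by simp
  qed
  then show ?thesis by simp
qed

section \<open>Matrices and the vorticity equation\<close>

lemma bounded_bilinear_matrix_vector_mult:
  "bounded_bilinear ((*v) :: real^'n^'m \<Rightarrow> real^'n \<Rightarrow> real^'m)"
  by (subst bilinear_conv_bounded_bilinear[symmetric])
     (auto simp: bilinear_def linear_iff algebra_simps matrix_vector_mult_add_rdistrib
        scaleR_matrix_vector_assoc matrix_vector_mult_scaleR matrix_vector_right_distrib)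

lemma bounded_bilinear_matrix_mult:
  "bounded_bilinear ((**) :: real^'n^'m \<Rightarrow> real^'p^'n \<Rightarrow> real^'p^'m)"
  by (subst bilinear_conv_bounded_bilinear[symmetric])
     (auto simp: bilinear_def linear_iff 
       vec_eq_iff matrix_matrix_mult_def sum_distrib_left algebra_simps sum.distrib)

lemma matrix_axis_entry: "(M *v axis j 1) $ i = M $ i $ j"
  for M :: "real^'n^'m"
  by (simp add: matrix_vector_mult_basis column_def)

text \<open>For symmetric \<open>A\<close> the trace of \<open>A ** A\<close> is the sum of the squares of all entries; keep the
  diagonal ones and apply the Cauchy-Schwarz inequality to them.\<close>

lemma trace_square_symmetric:
  fixes A :: "real^'n^'n"
  assumes "transpose A = A"
  shows "(trace A)\<^sup>2 / CARD('n) \<le> trace (A ** A)"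
proof -
  have sym: "A $ j $ i = A $ i $ j" for i j
    using arg_cong[OF assms, of "\<lambda>B. B $ i $ j"] by (simp add: transpose_def)
  have "(trace A)\<^sup>2 \<le> (\<Sum>i\<in>UNIV. (A $ i $ i)\<^sup>2) * CARD('n)"
    unfolding trace_def by (rule sum_squared_le_sum_of_squares)
  also have "(\<Sum>i\<in>UNIV. (A $ i $ i)\<^sup>2) \<le> (\<Sum>i\<in>UNIV. \<Sum>j\<in>UNIV. (A $ i $ j)\<^sup>2)"
    by (intro sum_mono member_le_sum) auto
  also have "\<dots> = trace (A ** A)"
    by (simp add: trace_def matrix_matrix_mult_def sym power2_eq_square)
  finally show ?thesis by (simp add: field_simps mult_right_mono)
qed

text \<open>The vorticity equation: along a path the skew part of the velocity gradient obeys a linear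
  homogeneous equation, so it stays zero if it is zero initially.\<close>

lemma riccati_preserves_symmetry:
  fixes M H :: "real \<Rightarrow> real^'n^'n"
  assumes M: "\<And>t. t \<in> {0..T} \<Longrightarrow> (M has_vector_derivative - k *\<^sub>R H t - M t ** M t) (at t within {0..T})"
    and H: "\<And>t. t \<in> {0..T} \<Longrightarrow> transpose (H t) = H t"
    and M0: "transpose (M 0) = M 0" and t: "t \<in> {0..T}"
  shows "transpose (M t) = M t"
proof -
  have tr: "bounded_linear (transpose :: real^'n^'n \<Rightarrow> real^'n^'n)"
    unfolding linear_conv_bounded_linear[symmetric] by (auto simp: linear_iff transpose_def vec_eq_iff)
  then interpret tr: bounded_linear "transpose :: real^'n^'n \<Rightarrow> real^'n^'n" .
  note trM = bounded_linear.has_vector_derivative[OF tr]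
  obtain K where K: "K > 0" "\<And>(A :: real^'n^'n) (B :: real^'n^'n). norm (A ** B) \<le> norm A * norm B * K"
    using bounded_bilinear.pos_bounded[OF bounded_bilinear_matrix_mult] by blast
  have M_cont: "continuous_on {0..T} M" by (rule continuous_on_vector_derivative[OF M])
  have "bounded (M ` {0..T} \<union> (\<lambda>t. transpose (M t)) ` {0..T})"
    by (intro compact_imp_bounded compact_Un compact_continuous_image M_cont
        bounded_linear.continuous_on[OF tr]) auto
  then obtain c where c: "\<forall>A \<in> M ` {0..T} \<union> (\<lambda>t. transpose (M t)) ` {0..T}. norm A \<le> c"
    unfolding bounded_iff by blast
  \<comment> \<open>\<open>M ** M - transpose M ** transpose M = M ** Y + Y ** transpose M\<close> is linear in \<open>Y\<close>, and the
     symmetric \<open>H\<close> cancels.\<close>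
  define Y where "Y t = M t - transpose (M t)" for t
  define Y' where "Y' t = - (M t ** Y t + Y t ** transpose (M t))" for t
  have "Y t = 0"
  proof (rule zero_if_derivative_linearly_bounded[where T=T and L="2 * c * K" and y'=Y'])
    fix s assume s: "s \<in> {0..T}"
    have "(Y has_vector_derivative (- k *\<^sub>R H s - M s ** M s) - transpose (- k *\<^sub>R H s - M s ** M s)) (at s within {0..T})"
      unfolding Y_def[abs_def] by (intro has_vector_derivative_diff M trM s)
    also have "transpose (- k *\<^sub>R H s - M s ** M s) = - k *\<^sub>R H s - transpose (M s) ** transpose (M s)"
      using H[OF s] by (simp add: tr.diff tr.scaleR tr.neg matrix_transpose_mul)
    also have "(- k *\<^sub>R H s - M s ** M s) - (- k *\<^sub>R H s - transpose (M s) ** transpose (M s)) = Y' s"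
      by (simp add: Y'_def Y_def bounded_bilinear.diff_left[OF bounded_bilinear_matrix_mult]
          bounded_bilinear.diff_right[OF bounded_bilinear_matrix_mult])
    finally show "(Y has_vector_derivative Y' s) (at s within {0..T})" .
    have "norm (Y' s) \<le> norm (M s ** Y s) + norm (Y s ** transpose (M s))"
      unfolding Y'_def norm_minus_cancel by (rule norm_triangle_ineq)
    also have "\<dots> \<le> norm (M s) * norm (Y s) * K + norm (Y s) * norm (transpose (M s)) * K"
      by (intro add_mono K(2))
    also have "\<dots> \<le> c * norm (Y s) * K + norm (Y s) * c * K"
      using c s K(1) by (intro add_mono mult_right_mono mult_left_mono) auto
    finally show "norm (Y' s) \<le> 2 * c * K * norm (Y s)" by (simp add: mult_ac)
  qed (use t M0 in \<open>auto simp: Y_def\<close>)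
  then show ?thesis by (simp add: Y_def)
qed

section \<open>The velocity gradient along a particle path\<close>

text \<open>Uniform continuity on a compact tube around the path.\<close>

lemma uniform_limit_shifted_path:
  fixes G :: "'a::euclidean_space \<times> real \<Rightarrow> 'b::metric_space"
  assumes G: "continuous_on (UNIV \<times> {0..}) G" and X: "continuous_on {0..T} X"
    and s: "s \<longlonglongrightarrow> 0"
  shows "uniform_limit {0..T} (\<lambda>m t. G (X t + s m *\<^sub>R \<xi>, t)) (\<lambda>t. G (X t, t)) sequentially"
proof -
  obtain R where R: "\<And>t. t \<in> {0..T} \<Longrightarrow> norm (X t) \<le> R"
    using compact_imp_bounded[OF compact_continuous_image[OF X compact_Icc]]
    by (meson bounded_iff imageI)
  define B where "B = cball (0::'a) (R + norm \<xi>) \<times> {0..T}"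
  have "compact B" unfolding B_def by (intro compact_Times) auto
  then have uc: "uniformly_continuous_on B G"
    by (rule compact_uniformly_continuous[rotated]) (auto intro!: continuous_on_subset[OF G] simp: B_def)
  have s1: "\<forall>\<^sub>F m in sequentially. \<bar>s m\<bar> < 1"
    using tendstoD[OF s, of 1] by simp
  have "uniform_limit {0..T} (\<lambda>m t. s m *\<^sub>R \<xi>) (\<lambda>t. 0) sequentially"
    using tendsto_scaleR[OF s tendsto_const[of \<xi>]]
    by (auto simp: uniform_limit_iff tendsto_iff elim: eventually_mono)
  then have "uniform_limit {0..T} (\<lambda>m t. (X t + s m *\<^sub>R \<xi>, t)) (\<lambda>t. (X t, t)) sequentially"
    by (auto simp: uniform_limit_iff dist_Pair_Pair dist_norm)
  moreover have "\<forall>\<^sub>F m in sequentially. \<forall>t\<in>{0..T}. (X t + s m *\<^sub>R \<xi>, t) \<in> B"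
    using s1
  proof eventually_elim
    case (elim m)
    show ?case
    proof
      fix t assume t: "t \<in> {0..T}"
      have "norm (X t + s m *\<^sub>R \<xi>) \<le> norm (X t) + \<bar>s m\<bar> * norm \<xi>"
        using norm_triangle_ineq[of "X t" "s m *\<^sub>R \<xi>"] by simp
      also have "\<dots> \<le> R + 1 * norm \<xi>"
        using R[OF t] elim by (intro add_mono mult_right_mono) auto
      finally show "(X t + s m *\<^sub>R \<xi>, t) \<in> B" using t by (simp add: B_def)
    qed
  qed
  ultimately show ?thesis
    using uc \<open>compact B\<close> compact_imp_closed
    by (intro uniform_limit_compose_uniformly_continuous_on[where B=B and f=G]) auto
qed

text \<open>Uniformity in time is the point here: it lets the limit of difference quotients be interchanged
  with the time derivative.\<close>

lemma uniform_limit_difference_quotient: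
  fixes G :: "(real^'n) \<times> real \<Rightarrow> real^'m" and M :: "(real^'n) \<times> real \<Rightarrow> real^'n^'m"
  assumes G: "\<And>x t. 0 \<le> t \<Longrightarrow> ((\<lambda>y. G (y, t)) has_derivative (\<lambda>h. M (x, t) *v h)) (at x)"
    and M: "continuous_on (UNIV \<times> {0..}) M" and X: "continuous_on {0..T} X"
    and s: "s \<longlonglongrightarrow> 0" "\<And>m. s m \<noteq> 0"
  shows "uniform_limit {0..T} (\<lambda>m t. (1 / s m) *\<^sub>R (G (X t + s m *\<^sub>R \<xi>, t) - G (X t, t)))
           (\<lambda>t. M (X t, t) *v \<xi>) sequentially"
proof (rule uniform_limitI)
  fix e :: real assume e: "e > 0"
  obtain K where K: "K > 0" "\<And>(A::real^'n^'m) h. norm (A *v h) \<le> norm A * norm h * K"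
    using bounded_bilinear.pos_bounded[OF bounded_bilinear_matrix_vector_mult] by blast
  \<comment> \<open>The linearisation error per unit step is \<open>norm \<xi> * K * e'\<close>; the \<open>+ 1\<close> covers \<open>\<xi> = 0\<close>.\<close>
  define e' where "e' = e / (2 * (norm \<xi> * K + 1))"
  have pos: "norm \<xi> * K + 1 > 0" using K(1) by (intro add_nonneg_pos) auto
  have e': "e' > 0" and e'_e: "norm \<xi> * K * e' < e"
  proof -
    show "e' > 0" using e pos by (simp add: e'_def)
    have "norm \<xi> * K * e' \<le> (norm \<xi> * K + 1) * e'" using \<open>e' > 0\<close> by simp
    also have "\<dots> = e / 2" using pos by (simp add: e'_def field_simps)
    finally show "norm \<xi> * K * e' < e" using e by simp
  qed
  obtain R where R: "\<And>t. t \<in> {0..T} \<Longrightarrow> norm (X t) \<le> R"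
    using compact_imp_bounded[OF compact_continuous_image[OF X compact_Icc]]
    by (meson bounded_iff imageI)
  define B where "B = cball (0::real^'n) (R + norm \<xi>) \<times> {0..T}"
  have "compact B" unfolding B_def by (intro compact_Times) auto
  then have uc: "uniformly_continuous_on B M"
    by (rule compact_uniformly_continuous[rotated]) (auto intro!: continuous_on_subset[OF M] simp: B_def)
  then obtain d where d: "d > 0" "\<And>z w. z \<in> B \<Longrightarrow> w \<in> B \<Longrightarrow> dist w z < d \<Longrightarrow> dist (M w) (M z) < e'"
    using e' unfolding uniformly_continuous_on_def by metis
  have s1: "\<forall>\<^sub>F m in sequentially. \<bar>s m\<bar> < 1"
    using tendstoD[OF s(1), of 1] by simp
  have "(\<lambda>m. \<bar>s m\<bar> * norm \<xi>) \<longlonglongrightarrow> 0"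
    using tendsto_mult[OF tendsto_rabs_zero[OF s(1)] tendsto_const[of "norm \<xi>"]] by simp
  then have "\<forall>\<^sub>F m in sequentially. \<bar>s m\<bar> * norm \<xi> < d"
    using d(1) by (rule order_tendstoD)
  with s1 show "\<forall>\<^sub>F m in sequentially. \<forall>t\<in>{0..T}.
     dist ((1 / s m) *\<^sub>R (G (X t + s m *\<^sub>R \<xi>, t) - G (X t, t))) (M (X t, t) *v \<xi>) < e"
  proof eventually_elim
    case (elim m)
    show ?case
    proof
      fix t assume t: "t \<in> {0..T}"
      define S where "S = {x. norm x \<le> R + norm \<xi> \<and> dist x (X t) < d}"
      have "norm (G (X t + s m *\<^sub>R \<xi>, t) - G (X t, t) - M (X t, t) *v ((X t + s m *\<^sub>R \<xi>) - X t))
          \<le> norm ((X t + s m *\<^sub>R \<xi>) - X t) * (K * e')"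
      proof (rule differentiable_bound_linearization[where S=S and f="\<lambda>y. G (y, t)"
              and f'="\<lambda>x h. M (x, t) *v h" and ?x0.0="X t"])
        fix \<tau> :: real assume \<tau>: "\<tau> \<in> {0..1}"
        then have "norm ((\<tau> * s m) *\<^sub>R \<xi>) \<le> \<bar>s m\<bar> * norm \<xi>"
          by (simp add: abs_mult mult.assoc mult_left_le_one_le)
        moreover have "\<bar>s m\<bar> * norm \<xi> \<le> 1 * norm \<xi>" using elim by (intro mult_right_mono) auto
        ultimately show "X t + \<tau> *\<^sub>R (X t + s m *\<^sub>R \<xi> - X t) \<in> S"
          using R[OF t] norm_triangle_ineq[of "X t" "(\<tau> * s m) *\<^sub>R \<xi>"] elim
          by (auto simp: S_def dist_norm)
      next
        fix x show "((\<lambda>y. G (y, t)) has_derivative (\<lambda>h. M (x, t) *v h)) (at x within S)"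
          using G[of t x] t by (auto intro: has_derivative_at_withinI)
      next
        fix x assume x: "x \<in> S"
        have "dist (M (x, t)) (M (X t, t)) < e'"
          using x t R[OF t] by (intro d) (auto simp: B_def S_def dist_Pair_Pair intro: add_increasing2)
        then have "norm (M (x, t) - M (X t, t)) \<le> e'" by (simp add: dist_norm)
        have "norm ((M (x, t) - M (X t, t)) *v h) \<le> K * e' * norm h" for h
        proof -
          have "norm ((M (x, t) - M (X t, t)) *v h) \<le> norm (M (x, t) - M (X t, t)) * norm h * K"
            by (rule K(2))
          also have "\<dots> \<le> e' * norm h * K"
            using \<open>norm (M (x, t) - M (X t, t)) \<le> e'\<close> K(1) by (intro mult_right_mono) auto
          finally show ?thesis by (simp add: mult_ac)
        qed
        then show "onorm ((\<lambda>h. M (x, t) *v h) - (\<lambda>h. M (X t, t) *v h)) \<le> K * e'"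
          by (intro onorm_le) (simp add: matrix_vector_mult_diff_rdistrib)
      next
        show "X t \<in> S" using R[OF t] d(1) by (simp add: S_def add_increasing2)
      qed
      then have "norm (G (X t + s m *\<^sub>R \<xi>, t) - G (X t, t) - s m *\<^sub>R (M (X t, t) *v \<xi>)) \<le> \<bar>s m\<bar> * (norm \<xi> * K * e')"
        by (simp add: mult_ac matrix_vector_mult_scaleR)
      moreover have "(1 / s m) *\<^sub>R (G (X t + s m *\<^sub>R \<xi>, t) - G (X t, t)) - M (X t, t) *v \<xi>
         = (1 / s m) *\<^sub>R (G (X t + s m *\<^sub>R \<xi>, t) - G (X t, t) - s m *\<^sub>R (M (X t, t) *v \<xi>))"
        using s(2)[of m] by (simp add: scaleR_diff_right)
      ultimately have "norm ((1 / s m) *\<^sub>R (G (X t + s m *\<^sub>R \<xi>, t) - G (X t, t)) - M (X t, t) *v \<xi>) \<le> norm \<xi> * K * e'"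
        using s(2)[of m] by (simp add: divide_simps mult_ac)
      then show "dist ((1 / s m) *\<^sub>R (G (X t + s m *\<^sub>R \<xi>, t) - G (X t, t))) (M (X t, t) *v \<xi>) < e"
        using e'_e by (simp add: dist_norm)
    qed
  qed
qed

text \<open>Formally this is the gradient of \<open>\<partial>\<^sub>t V + (V \<bullet> \<nabla>) V = - k g\<close>, but \<open>V\<close> is only \<open>C\<^sup>1\<close> and has no
  second derivatives. Instead, translate the path by a fixed small vector \<open>s *\<^sub>R \<xi>\<close> and
  differentiate the quotient \<open>(V (X t + s *\<^sub>R \<xi>, t) - V (X t, t)) / s\<close> in time. By the
  equation of motion its derivative is made of the difference quotients of \<open>g\<close> and \<open>V\<close> in
  space only. All of these converge uniformly as \<open>s\<close> tends to \<open>0\<close>, so the limit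
  \<open>A (X t, t) *v \<xi>\<close> is differentiable and its derivative is the limit of the derivatives.
  No flow map and no differentiability with respect to initial data enter.\<close>

lemma velocity_gradient_along_path:
  fixes V g :: "(real^'n) \<times> real \<Rightarrow> real^'n" and A H :: "(real^'n) \<times> real \<Rightarrow> real^'n^'n"
  assumes V: "\<And>z. z \<in> UNIV \<times> {0..} \<Longrightarrow> (V has_derivative D z) (at z within UNIV \<times> {0..})"
    and A: "\<And>x t h. 0 \<le> t \<Longrightarrow> A (x, t) *v h = D (x, t) (h, 0)"
    and A_cont: "continuous_on (UNIV \<times> {0..}) A"
    and g: "\<And>x t. 0 \<le> t \<Longrightarrow> ((\<lambda>y. g (y, t)) has_derivative (\<lambda>h. H (x, t) *v h)) (at x)"
    and H_cont: "continuous_on (UNIV \<times> {0..}) H"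
    and X: "\<And>t. t \<in> {0..T} \<Longrightarrow> (X has_vector_derivative V (X t, t)) (at t within {0..T})"
    and "r > 0"
    and accel: "\<And>t y. t \<in> {0..T} \<Longrightarrow> dist y (X t) < r \<Longrightarrow> D (y, t) (V (y, t), 1) = - k *\<^sub>R g (y, t)"
    and t: "t \<in> {0..T}"
  shows "((\<lambda>t. A (X t, t)) has_vector_derivative - k *\<^sub>R H (X t, t) - A (X t, t) ** A (X t, t)) (at t within {0..T})"
proof -
  have X_cont: "continuous_on {0..T} X" by (rule continuous_on_vector_derivative[OF X])
  have path_cont: "continuous_on {0..T} (\<lambda>t. F (X t, t))" if "continuous_on (UNIV \<times> {0..}) F"
    for F :: "(real^'n) \<times> real \<Rightarrow> 'b::topological_space"
    by (rule continuous_on_compose2[OF that]) (auto intro!: continuous_intros X_cont)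
  note bv = bounded_bilinear_matrix_vector_mult
  note path_bdd = compact_imp_bounded[OF compact_continuous_image[OF _ compact_Icc]]
  have V_slice: "((\<lambda>y. V (y, t)) has_derivative (\<lambda>h. A (x, t) *v h)) (at x)" if "0 \<le> t" for x t
    using has_derivative_spatial_slice[OF V, of x t] that by (simp add: A)
  have column: "((\<lambda>t. A (X t, t) *v \<xi>) has_vector_derivative
      - k *\<^sub>R (H (X t, t) *v \<xi>) - A (X t, t) *v (A (X t, t) *v \<xi>)) (at t within {0..T})" for \<xi>
  proof -
    \<comment> \<open>Steps tending to \<open>0\<close> and so small that \<open>X t + s m *\<^sub>R \<xi>\<close> stays where \<open>accel\<close> holds.\<close>
    define N where "N = norm \<xi> + 1"
    define s where "s m = r / (2 * N) * inverse (real (Suc m))" for m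
    have N: "N > 0" "norm \<xi> \<le> N" by (auto simp: N_def add_nonneg_pos)
    then have c: "r / (2 * N) > 0" using \<open>r > 0\<close> by simp
    have s_pos: "s m > 0" for m unfolding s_def by (intro mult_pos_pos c) simp
    have s_lim: "s \<longlonglongrightarrow> 0"
      unfolding s_def by (rule tendsto_mult_right_zero[OF LIMSEQ_inverse_real_of_nat])
    have s_r: "s m * norm \<xi> < r" for m
    proof -
      have "s m \<le> r / (2 * N)"
        unfolding s_def using c by (intro mult_right_le_one_le) (auto simp: inverse_le_1_iff)
      then have "s m * norm \<xi> \<le> r / (2 * N) * norm \<xi>" by (intro mult_right_mono) auto
      also have "\<dots> \<le> r / (2 * N) * N" using c N by (intro mult_left_mono) auto
      also have "\<dots> = r / 2" using N by simp
      also have "\<dots> < r" using \<open>r > 0\<close> by simp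
      finally show ?thesis .
    qed
    define Y where "Y m t = X t + s m *\<^sub>R \<xi>" for m t
    define Q where "Q m t = (1 / s m) *\<^sub>R (V (Y m t, t) - V (X t, t))" for m t
    define Q' where "Q' m t = - k *\<^sub>R ((1 / s m) *\<^sub>R (g (Y m t, t) - g (X t, t))) - A (Y m t, t) *v Q m t" for m t
    define L' where "L' t = - k *\<^sub>R (H (X t, t) *v \<xi>) - A (X t, t) *v (A (X t, t) *v \<xi>)" for t
    have lim_V: "uniform_limit {0..T} Q (\<lambda>t. A (X t, t) *v \<xi>) sequentially"
      unfolding Q_def Y_def using s_pos
      by (intro uniform_limit_difference_quotient V_slice A_cont X_cont s_lim) (auto simp: less_imp_neq[symmetric])
    have lim_g: "uniform_limit {0..T} (\<lambda>m t. (1 / s m) *\<^sub>R (g (Y m t, t) - g (X t, t))) (\<lambda>t. H (X t, t) *v \<xi>) sequentially"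
      unfolding Y_def using s_pos
      by (intro uniform_limit_difference_quotient g H_cont X_cont s_lim) (auto simp: less_imp_neq[symmetric])
    have lim_A: "uniform_limit {0..T} (\<lambda>m t. A (Y m t, t)) (\<lambda>t. A (X t, t)) sequentially"
      unfolding Y_def by (rule uniform_limit_shifted_path[OF A_cont X_cont s_lim])
    have "uniform_limit {0..T} (\<lambda>m t. A (Y m t, t) *v Q m t) (\<lambda>t. A (X t, t) *v (A (X t, t) *v \<xi>)) sequentially"
    proof (rule bounded_bilinear.bounded_uniform_limit[OF bv lim_A lim_V])
      show "bounded ((\<lambda>t. A (X t, t) *v \<xi>) ` {0..T})"
        by (intro path_bdd bounded_bilinear.continuous_on[OF bv] path_cont A_cont continuous_intros)
      show "bounded ((\<lambda>t. A (X t, t)) ` {0..T})"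
        by (intro path_bdd path_cont A_cont)
    qed
    then have lim_Q': "uniform_limit {0..T} Q' L' sequentially"
      unfolding Q'_def L'_def by (intro uniform_limit_intros lim_g)
    have Q: "(Q m has_vector_derivative Q' m t) (at t within {0..T})" if t: "t \<in> {0..T}" for m t
    proof -
      have Yt: "((\<lambda>t. V (Y m t, t)) has_vector_derivative D (Y m t, t) (V (X t, t), 1)) (at t within {0..T})"
      proof (rule has_vector_derivative_along_path[where X="Y m", OF V])
        show "(Y m has_vector_derivative V (X t, t)) (at t within {0..T})"
          unfolding Y_def[abs_def] using X[OF t] by (auto intro!: derivative_eq_intros)
      qed (use t in auto)
      have Xt: "((\<lambda>t. V (X t, t)) has_vector_derivative D (X t, t) (V (X t, t), 1)) (at t within {0..T})"
        by (rule has_vector_derivative_along_path[OF V]) (use t X in auto)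
      interpret D: bounded_linear "D (Y m t, t)"
        using V[of "(Y m t, t)"] t by (auto intro: has_derivative_bounded_linear)
      \<comment> \<open>The translated path \<open>Y m\<close> moves with velocity \<open>V (X t, t)\<close>, not with the velocity of the
         fluid at \<open>Y m t\<close>; the mismatch is what produces the quadratic term in the limit.\<close>
      have "D (Y m t, t) (V (X t, t), 1)
          = D (Y m t, t) (V (Y m t, t), 1) - D (Y m t, t) (V (Y m t, t) - V (X t, t), 0)"
        by (simp flip: D.diff)
      also have "D (Y m t, t) (V (Y m t, t), 1) = - k *\<^sub>R g (Y m t, t)"
        using t s_r[of m] s_pos[of m] by (intro accel) (auto simp: Y_def dist_norm)
      also have "D (Y m t, t) (V (Y m t, t) - V (X t, t), 0) = A (Y m t, t) *v (V (Y m t, t) - V (X t, t))"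
        using t by (simp add: A)
      finally have 1: "D (Y m t, t) (V (X t, t), 1)
          = - k *\<^sub>R g (Y m t, t) - A (Y m t, t) *v (V (Y m t, t) - V (X t, t))" .
      have 2: "D (X t, t) (V (X t, t), 1) = - k *\<^sub>R g (X t, t)"
        using t \<open>r > 0\<close> by (intro accel) auto
      have "(1 / s m) *\<^sub>R (D (Y m t, t) (V (X t, t), 1) - D (X t, t) (V (X t, t), 1)) = Q' m t"
        unfolding 1 2 Q'_def Q_def by (simp add: matrix_vector_mult_scaleR algebra_simps)
      then show ?thesis
        unfolding Q_def[abs_def] using Yt Xt by (auto intro!: derivative_eq_intros)
    qed
    have "0 \<in> {0..T}" using t by auto
    have "\<exists>q. \<forall>t\<in>{0..T}. (\<lambda>m. Q m t) \<longlonglongrightarrow> q t \<and> (q has_derivative (\<lambda>h. h *\<^sub>R L' t)) (at t within {0..T})"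
    proof (rule has_derivative_sequence[where ?x0.0=0 and f'="\<lambda>m t h. h *\<^sub>R Q' m t"])
      show "(\<lambda>m. Q m 0) \<longlonglongrightarrow> A (X 0, 0) *v \<xi>"
        by (rule tendsto_uniform_limitI[OF lim_V \<open>0 \<in> {0..T}\<close>])
      show "(Q m has_derivative (\<lambda>h. h *\<^sub>R Q' m t)) (at t within {0..T})" if "t \<in> {0..T}" for m t
        using Q[OF that] by (simp add: has_vector_derivative_def)
      fix e :: real assume "e > 0"
      from uniform_limitD[OF lim_Q' this]
      show "\<forall>\<^sub>F m in sequentially. \<forall>t\<in>{0..T}. \<forall>h. norm (h *\<^sub>R Q' m t - h *\<^sub>R L' t) \<le> e * norm h"
      proof eventually_elim
        case (elim m)
        then have "\<bar>h\<bar> * norm (Q' m t - L' t) \<le> \<bar>h\<bar> * e" if "t \<in> {0..T}" for t h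
          using that by (intro mult_left_mono) (auto simp: dist_norm less_imp_le)
        then show ?case by (simp add: mult.commute flip: scaleR_diff_right)
      qed
    qed (use \<open>0 \<in> {0..T}\<close> in auto)
    then obtain q where q: "\<And>t. t \<in> {0..T} \<Longrightarrow> (\<lambda>m. Q m t) \<longlonglongrightarrow> q t"
      "(q has_vector_derivative L' t) (at t within {0..T})"
      using t unfolding has_vector_derivative_def by blast
    have "q t = A (X t, t) *v \<xi>" if "t \<in> {0..T}" for t
      using q(1)[OF that] tendsto_uniform_limitI[OF lim_V that] by (rule LIMSEQ_unique)
    then show ?thesis
      using has_vector_derivative_transform[OF t _ q(2), of "\<lambda>t. A (X t, t) *v \<xi>"] by (simp add: L'_def)
  qed
  show ?thesis
  proof (intro has_vector_derivative_vecI)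
    fix i j
    have "((\<lambda>t. (A (X t, t) *v axis j 1) $ i) has_vector_derivative
       (- k *\<^sub>R (H (X t, t) *v axis j 1) - A (X t, t) *v (A (X t, t) *v axis j 1)) $ i) (at t within {0..T})"
      by (rule bounded_linear.has_vector_derivative[OF bounded_linear_vec_nth column])
    then show "((\<lambda>t. A (X t, t) $ i $ j) has_vector_derivative
       (- k *\<^sub>R H (X t, t) - A (X t, t) ** A (X t, t)) $ i $ j) (at t within {0..T})"
      by (simp add: matrix_axis_entry matrix_vector_mul_assoc)
  qed
qed

section \<open>Finite-time blow-up for the Euler-Poisson equations\<close>

text \<open>The equations rewritten with total derivatives. \<open>D (x, t) (v x t, 1)\<close> is the material
  derivative of the velocity: the momentum equation determines it only after division by \<open>\<rho>\<close>,
  hence only off the vacuum.\<close>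

lemma euler_poisson_pointwise:
  fixes v :: "real^'n \<Rightarrow> real \<Rightarrow> real^'n"
  assumes sol: "global_C1_solution k v\<^sub>0 \<rho>\<^sub>0 v \<rho> \<phi>"
  obtains D :: "(real^'n) \<times> real \<Rightarrow> ((real^'n) \<times> real) \<Rightarrow>\<^sub>L (real^'n)"
    and R :: "(real^'n) \<times> real \<Rightarrow> ((real^'n) \<times> real) \<Rightarrow>\<^sub>L real"
    and g :: "(real^'n) \<times> real \<Rightarrow> real^'n" and H :: "(real^'n) \<times> real \<Rightarrow> real^'n^'n"
  where
    "\<And>z. z \<in> UNIV \<times> {0..} \<Longrightarrow> ((\<lambda>(x, t). v x t) has_derivative D z) (at z within UNIV \<times> {0..})"
    "continuous_on (UNIV \<times> {0..}) D"
    "\<And>z. z \<in> UNIV \<times> {0..} \<Longrightarrow> ((\<lambda>(x, t). \<rho> x t) has_derivative R z) (at z within UNIV \<times> {0..})"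
    "\<And>x t. 0 \<le> t \<Longrightarrow> ((\<lambda>y. g (y, t)) has_derivative (\<lambda>h. H (x, t) *v h)) (at x)"
    "continuous_on (UNIV \<times> {0..}) H"
    "\<And>x t. 0 \<le> t \<Longrightarrow> transpose (H (x, t)) = H (x, t)"
    "\<And>x t. 0 \<le> t \<Longrightarrow> trace (H (x, t)) = \<rho> x t"
    "\<And>x t. 0 \<le> t \<Longrightarrow> R (x, t) (v x t, 1) = - \<rho> x t * divergence (\<lambda>y. v y t) x"
    "\<And>x t. 0 \<le> t \<Longrightarrow> \<rho> x t > 0 \<Longrightarrow> D (x, t) (v x t, 1) = - k *\<^sub>R g (x, t)"
proof -
  have "C1_on (\<lambda>(x, t). v x t) (UNIV \<times> {0..})" and "C1_on (\<lambda>(x, t). \<rho> x t) (UNIV \<times> {0..})" and "C2_in_space \<phi>"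
    using sol unfolding global_C1_solution_def by simp_all
  from this(1) obtain D where D: "\<And>z. z \<in> UNIV \<times> {0..} \<Longrightarrow> ((\<lambda>(x, t). v x t) has_derivative blinfun_apply (D z)) (at z within UNIV \<times> {0..})"
     "continuous_on (UNIV \<times> {0..}) D"
    unfolding C1_on_def by metis
  from \<open>C1_on (\<lambda>(x, t). \<rho> x t) (UNIV \<times> {0..})\<close>
  obtain R where R: "\<And>z. z \<in> UNIV \<times> {0..} \<Longrightarrow> ((\<lambda>(x, t). \<rho> x t) has_derivative blinfun_apply (R z)) (at z within UNIV \<times> {0..})"
    unfolding C1_on_def by metis
  from \<open>C2_in_space \<phi>\<close> obtain g :: "real^'n \<Rightarrow> real \<Rightarrow> real^'n" and H where
    \<phi>: "\<And>x t. 0 \<le> t \<Longrightarrow> ((\<lambda>y. \<phi> y t) has_derivative (\<lambda>h. g x t \<bullet> h)) (at x)"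
    and g: "\<And>x t. 0 \<le> t \<Longrightarrow> ((\<lambda>y. g y t) has_derivative (\<lambda>h. H x t *v h)) (at x)"
    and H: "continuous_on (UNIV \<times> {0..}) (\<lambda>(x, t). H x t)"
    unfolding C2_in_space_def by metis
  have eq_mass: "time_deriv (\<lambda>s. \<rho> x s) t + divergence (\<lambda>y. \<rho> y t *\<^sub>R v y t) x = 0"
    and eq_mom: "time_deriv (\<lambda>s. \<rho> x s * v x s $ i) t + divergence (\<lambda>y. (\<rho> y t * v y t $ i) *\<^sub>R v y t) x
        = - k * \<rho> x t * partial_deriv i (\<lambda>y. \<phi> y t) x"
    and eq_pot: "laplacian (\<lambda>y. \<phi> y t) x = \<rho> x t" if "0 \<le> t" for x t i
    using sol that unfolding global_C1_solution_def by simp_all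
  have D_slice: "((\<lambda>y. v y t) has_derivative (\<lambda>h. D (x, t) (h, 0))) (at x)" if "0 \<le> t" for x t
    using has_derivative_spatial_slice[OF D(1), of x t] that by simp
  have R_slice: "((\<lambda>y. \<rho> y t) has_derivative (\<lambda>h. R (x, t) (h, 0))) (at x)" if "0 \<le> t" for x t
    using has_derivative_spatial_slice[OF R, of x t] that by simp
  have D_time: "((\<lambda>s. v x s) has_vector_derivative D (x, t) (0, 1)) (at t within {0..})" if "0 \<le> t" for x t
    using has_vector_derivative_along_path[where X="\<lambda>_. x" and t=t, OF D(1), of 0 "{0..}"] that by simp
  have R_time: "((\<lambda>s. \<rho> x s) has_vector_derivative R (x, t) (0, 1)) (at t within {0..})" if "0 \<le> t" for x t
    using has_vector_derivative_along_path[where X="\<lambda>_. x" and t=t, OF R, of 0 "{0..}"] that by simp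
  have split: "blinfun_apply F (h, 1) = blinfun_apply F (h, 0) + blinfun_apply F (0, 1)"
    for F :: "((real^'n) \<times> real) \<Rightarrow>\<^sub>L 'z::real_normed_vector" and h
    by (simp flip: blinfun.add_right)
  have mass: "R (x, t) (0, 1) + (R (x, t) (v x t, 0) + \<rho> x t * divergence (\<lambda>y. v y t) x) = 0" if t: "0 \<le> t" for x t
    using eq_mass[OF t, of x] divergence_scaleR[OF R_slice[OF t] D_slice[OF t], of x]
      time_deriv_eq[OF R_time[OF t, of x] t] by simp
  have p\<phi>: "partial_deriv i (\<lambda>y. \<phi> y t) = (\<lambda>x. g x t $ i)" if "0 \<le> t" for i t
    using partial_deriv_eq[OF \<phi>[OF that]] by (auto simp: fun_eq_iff inner_axis)
  have mom: "D (x, t) (v x t, 1) = - k *\<^sub>R g x t" if t: "0 \<le> t" and pos: "\<rho> x t > 0" for x t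
  proof -
    have "D (x, t) (v x t, 1) $ i = - k * g x t $ i" for i
    proof -
      have "((\<lambda>s. \<rho> x s * v x s $ i) has_vector_derivative
          \<rho> x t * D (x, t) (0, 1) $ i + R (x, t) (0, 1) * v x t $ i) (at t within {0..})"
        using has_vector_derivative_mult[OF R_time[OF t, of x]
            bounded_linear.has_vector_derivative[OF bounded_linear_vec_nth D_time[OF t, of x], of i]] .
      then have td: "time_deriv (\<lambda>s. \<rho> x s * v x s $ i) t = \<rho> x t * D (x, t) (0, 1) $ i + R (x, t) (0, 1) * v x t $ i"
        using t by (rule time_deriv_eq)
      have dv: "divergence (\<lambda>y. (\<rho> y t * v y t $ i) *\<^sub>R v y t) x
         = (\<rho> x t * D (x, t) (v x t, 0) $ i + R (x, t) (v x t, 0) * v x t $ i)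
           + \<rho> x t * v x t $ i * divergence (\<lambda>y. v y t) x"
        by (rule divergence_scaleR[OF has_derivative_mult[OF R_slice[OF t] has_derivative_nth[OF D_slice[OF t]]] D_slice[OF t]])
      \<comment> \<open>The momentum balance is \<open>\<rho>\<close> times the acceleration plus \<open>v\<^sup>i\<close> times the mass balance.\<close>
      have "\<rho> x t * (D (x, t) (v x t, 1) $ i)
          + v x t $ i * (R (x, t) (0, 1) + (R (x, t) (v x t, 0) + \<rho> x t * divergence (\<lambda>y. v y t) x))
        = time_deriv (\<lambda>s. \<rho> x s * v x s $ i) t + divergence (\<lambda>y. (\<rho> y t * v y t $ i) *\<^sub>R v y t) x"
        unfolding td dv split[of "D (x, t)" "v x t"] by (simp add: algebra_simps)
      also have "\<dots> = \<rho> x t * (- k * g x t $ i)"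
        using eq_mom[OF t, of x i] by (simp add: p\<phi>[OF t])
      finally have "\<rho> x t * (D (x, t) (v x t, 1) $ i) = \<rho> x t * (- k * g x t $ i)"
        using mass[OF t, of x] by simp
      from this[unfolded mult_cancel_left] show ?thesis using pos by auto
    qed
    then show ?thesis by (simp add: vec_eq_iff)
  qed
  show thesis
  proof (rule that[of D R "\<lambda>(x, t). g x t" "\<lambda>(x, t). H x t"])
    show "transpose (case (x, t) of (x, t) \<Rightarrow> H x t) = (case (x, t) of (x, t) \<Rightarrow> H x t)" if "0 \<le> t" for x t
    proof -
      have "H x t $ i $ j = H x t $ j $ i" for i j
        using second_derivative_symmetric[OF \<phi>[OF that] g[OF that], of x "axis j 1" "axis i 1"]
        by (simp add: inner_axis matrix_axis_entry)
      then show ?thesis by (simp add: vec_eq_iff transpose_def)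
    qed
    show "trace (case (x, t) of (x, t) \<Rightarrow> H x t) = \<rho> x t" if t: "0 \<le> t" for x t
    proof -
      have "laplacian (\<lambda>y. \<phi> y t) x = trace (H x t)"
        unfolding laplacian_def p\<phi>[OF t] trace_def
        using partial_deriv_eq[OF has_derivative_nth[OF g[OF t]]] by (simp add: matrix_axis_entry)
      then show ?thesis using eq_pot[OF t, of x] by simp
    qed
    show "R (x, t) (v x t, 1) = - \<rho> x t * divergence (\<lambda>y. v y t) x" if "0 \<le> t" for x t
      using mass[OF that, of x] by (simp add: split[of _ "v x t"])
    show "((\<lambda>y. case (y, t) of (x, t) \<Rightarrow> g x t) has_derivative (\<lambda>h. (case (x, t) of (x, t) \<Rightarrow> H x t) *v h)) (at x)"
      if "0 \<le> t" for x t using g[OF that] by simp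
    show "D (x, t) (v x t, 1) = - k *\<^sub>R (case (x, t) of (x, t) \<Rightarrow> g x t)" if "0 \<le> t" "\<rho> x t > 0" for x t
      using mom[OF that] by simp
  qed (fact D R H)+
qed

text \<open>The equation of motion is available only where there is mass, and the comparison with translated
  paths needs it in a whole tube around the path.\<close>

lemma positive_near_path:
  fixes f :: "'a::euclidean_space \<times> real \<Rightarrow> real"
  assumes f: "continuous_on (UNIV \<times> {0..}) f" and X: "continuous_on {0..T} X" and "0 \<le> T"
    and pos: "\<And>t. t \<in> {0..T} \<Longrightarrow> f (X t, t) > 0"
  obtains r where "r > 0" "\<And>t y. t \<in> {0..T} \<Longrightarrow> dist y (X t) < r \<Longrightarrow> f (y, t) > 0"
proof -
  have "continuous_on {0..T} (\<lambda>t. f (X t, t))"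
    by (rule continuous_on_compose2[OF f]) (auto intro!: continuous_intros X)
  then obtain t\<^sub>0 where t\<^sub>0: "t\<^sub>0 \<in> {0..T}" "\<forall>t\<in>{0..T}. f (X t\<^sub>0, t\<^sub>0) \<le> f (X t, t)"
    using continuous_attains_inf[of "{0..T}" "\<lambda>t. f (X t, t)"] \<open>0 \<le> T\<close> by auto
  obtain R where R: "\<And>t. t \<in> {0..T} \<Longrightarrow> norm (X t) \<le> R"
    using compact_imp_bounded[OF compact_continuous_image[OF X compact_Icc]]
    by (meson bounded_iff imageI)
  define B where "B = cball (0::'a) (R + 1) \<times> {0..T}"
  have "compact B" unfolding B_def by (intro compact_Times) auto
  then have uc: "uniformly_continuous_on B f"
    by (rule compact_uniformly_continuous[rotated]) (auto intro!: continuous_on_subset[OF f] simp: B_def)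
  then obtain \<delta> where \<delta>: "\<delta> > 0" "\<And>z w. z \<in> B \<Longrightarrow> w \<in> B \<Longrightarrow> dist w z < \<delta> \<Longrightarrow> dist (f w) (f z) < f (X t\<^sub>0, t\<^sub>0)"
    using pos[OF t\<^sub>0(1)] unfolding uniformly_continuous_on_def by metis
  show thesis
  proof (rule that[of "min \<delta> 1"])
    show "min \<delta> 1 > 0" using \<delta>(1) by simp
    fix t y assume t: "t \<in> {0..T}" and y: "dist y (X t) < min \<delta> 1"
    have "norm y \<le> R + 1"
      using R[OF t] y norm_triangle_sub[of y "X t"] by (simp add: dist_norm)
    moreover have "norm (X t) \<le> R + 1" using R[OF t] by simp
    ultimately have "dist (f (y, t)) (f (X t, t)) < f (X t\<^sub>0, t\<^sub>0)"
      using t y by (intro \<delta>(2)) (auto simp: B_def dist_Pair_Pair)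
    then show "f (y, t) > 0" using t\<^sub>0(2) t by (force simp: dist_real_def)
  qed
qed

theorem theorem1p1:
  fixes k :: real
    and v\<^sub>0 :: "real^'n::finite \<Rightarrow> real^'n"
    and \<rho>\<^sub>0 :: "real^'n \<Rightarrow> real"
  assumes "k > 0"
    and "blowup_set k v\<^sub>0 \<rho>\<^sub>0 \<noteq> {}"
  shows "\<not> (\<exists>v \<rho> \<phi>. global_C1_solution k v\<^sub>0 \<rho>\<^sub>0 v \<rho> \<phi> \<and> no_mass_escape \<rho>\<^sub>0 v)"
proof
  assume "\<exists>v \<rho> \<phi>. global_C1_solution k v\<^sub>0 \<rho>\<^sub>0 v \<rho> \<phi> \<and> no_mass_escape \<rho>\<^sub>0 v"
  then obtain v \<rho> \<phi> where sol: "global_C1_solution k v\<^sub>0 \<rho>\<^sub>0 v \<rho> \<phi>" and esc: "no_mass_escape \<rho>\<^sub>0 v"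
    by blast
  obtain a where vort: "vorticity v\<^sub>0 a = 0" and div0: "divergence v\<^sub>0 a < 0" and \<rho>0: "\<rho>\<^sub>0 a > 0"
  proof -
    obtain a where a: "vorticity v\<^sub>0 a = 0" "- divergence v\<^sub>0 a \<ge> sqrt (2 * k * \<rho>\<^sub>0 a / 3)" "sqrt (2 * k * \<rho>\<^sub>0 a / 3) > 0"
      using assms(2) by (auto simp: blowup_set_def)
    have "divergence v\<^sub>0 a < 0" using a(2,3) by linarith
    moreover have "\<rho>\<^sub>0 a > 0" using a(3) \<open>k > 0\<close> by (simp add: zero_less_mult_iff)
    ultimately show thesis using a(1) by (intro that[of a])
  qed
  have v_init: "(\<lambda>y. v y 0) = v\<^sub>0" and \<rho>_init: "\<rho> a 0 = \<rho>\<^sub>0 a" and \<rho>_nonneg: "\<And>x t. 0 \<le> t \<Longrightarrow> 0 \<le> \<rho> x t"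
    using sol by (auto simp: global_C1_solution_def)
  obtain D R g H where
    D: "\<And>z. z \<in> UNIV \<times> {0..} \<Longrightarrow> ((\<lambda>(x, t). v x t) has_derivative blinfun_apply (D z)) (at z within UNIV \<times> {0..})"
    and D_cont: "continuous_on (UNIV \<times> {0..}) D"
    and R: "\<And>z. z \<in> UNIV \<times> {0..} \<Longrightarrow> ((\<lambda>(x, t). \<rho> x t) has_derivative blinfun_apply (R z)) (at z within UNIV \<times> {0..})"
    and g: "\<And>x t. 0 \<le> t \<Longrightarrow> ((\<lambda>y. g (y, t)) has_derivative (\<lambda>h. H (x, t) *v h)) (at x)"
    and H_cont: "continuous_on (UNIV \<times> {0..}) H"
    and H_sym: "\<And>x t. 0 \<le> t \<Longrightarrow> transpose (H (x, t)) = H (x, t)"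
    and H_trace: "\<And>x t. 0 \<le> t \<Longrightarrow> trace (H (x, t)) = \<rho> x t"
    and mass: "\<And>x t. 0 \<le> t \<Longrightarrow> R (x, t) (v x t, 1) = - \<rho> x t * divergence (\<lambda>y. v y t) x"
    and accel: "\<And>x t. 0 \<le> t \<Longrightarrow> \<rho> x t > 0 \<Longrightarrow> D (x, t) (v x t, 1) = - k *\<^sub>R g (x, t)"
    using euler_poisson_pointwise[OF sol] by blast
  define A where "A z = matrix (\<lambda>h. D z (h, 0))" for z
  have A_entry: "A z $ i $ j = D z (axis j 1, 0) $ i" for z i j by (simp add: A_def matrix_def)
  have A: "A z *v h = D z (h, 0)" for z h
  proof -
    have "linear (\<lambda>h. D z (h, 0))"
      by (auto simp: linear_iff simp flip: blinfun.add_right blinfun.scaleR_right)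
    then show ?thesis
      unfolding A_def linear_matrix_vector_mul_eq[symmetric] by (rule matrix_works)
  qed
  have A_cont: "continuous_on (UNIV \<times> {0..}) A"
    unfolding A_def matrix_def
    by (intro continuous_on_vec_lambda continuous_intros D_cont)
  have v_slice: "((\<lambda>y. v y t) has_derivative (\<lambda>h. D (x, t) (h, 0))) (at x)" if "0 \<le> t" for x t
    using has_derivative_spatial_slice[OF D, of x t] that by simp
  have div_A: "divergence (\<lambda>y. v y t) x = trace (A (x, t))" if "0 \<le> t" for x t
    by (simp add: divergence_eq[OF v_slice[OF that]] trace_def A_entry)
  \<comment> \<open>The time by which \<open>d' \<le> - d\<^sup>2 / n\<close> drives \<open>d\<close> to \<open>- \<infinity>\<close>.\<close>
  define T where "T = - real CARD('n) / trace (A (a, 0))"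
  have d0: "trace (A (a, 0)) < 0" using div0 div_A[of 0 a] v_init by simp
  then have "0 \<le> T" by (simp add: T_def divide_nonneg_neg)
  obtain X where X0: "X 0 = a"
    and X: "\<And>t. t \<in> {0..T} \<Longrightarrow> (X has_vector_derivative v (X t) t) (at t within {0..T})"
  proof (rule global_path[where T=T])
    show "continuous_on (UNIV \<times> {0..}) (\<lambda>(x, t). v x t)"
      using has_derivative_continuous_on[OF D] .
    show "\<exists>L\<ge>0. \<forall>t\<in>{0..T}. \<forall>x\<in>cball 0 r. \<forall>y\<in>cball 0 r. norm (v x t - v y t) \<le> L * norm (x - y)" for r T
      using C1_lipschitz_on_balls[OF D D_cont, of T r] by simp
    show "bounded (Z ` {0..<S})" if "Z 0 = a"
      "\<And>t. t \<in> {0..<S} \<Longrightarrow> (Z has_vector_derivative v (Z t) t) (at t within {0..<S})" for S Z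
      using esc \<rho>0 that unfolding no_mass_escape_def by blast
    fix Z assume "Z 0 = a" "\<And>t. t \<in> {0..T} \<Longrightarrow> (Z has_vector_derivative v (Z t) t) (at t within {0..T})"
    then show thesis by (rule that)
  qed
  have X_cont: "continuous_on {0..T} X" by (rule continuous_on_vector_derivative[OF X])
  have path_cont: "continuous_on {0..T} (\<lambda>t. trace (A (X t, t)))"
    unfolding trace_def
    by (intro continuous_intros continuous_on_compose2[OF A_cont]) (auto intro!: continuous_intros X_cont)
  have "((\<lambda>s. \<rho> (X s) s) has_vector_derivative - \<rho> (X t) t * trace (A (X t, t))) (at t within {0..T})"
    if "t \<in> {0..T}" for t
    using has_vector_derivative_along_path[where X=X and t=t, OF R X[OF that]] that mass[of t "X t"] div_A[of t "X t"] by simp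
  then have \<rho>_pos: "\<rho> (X t) t > 0" if "t \<in> {0..T}" for t
    by (rule positive_if_linear_ode[where q="\<lambda>s. \<rho> (X s) s" and d="\<lambda>t. trace (A (X t, t))"])
       (use that path_cont \<rho>0 \<rho>_init X0 \<rho>_nonneg in auto)
  obtain r where r: "r > 0" "\<And>t y. t \<in> {0..T} \<Longrightarrow> dist y (X t) < r \<Longrightarrow> \<rho> y t > 0"
    using positive_near_path[OF has_derivative_continuous_on[OF R] X_cont \<open>0 \<le> T\<close>] \<rho>_pos by auto
  have dA: "((\<lambda>t. A (X t, t)) has_vector_derivative - k *\<^sub>R H (X t, t) - A (X t, t) ** A (X t, t)) (at t within {0..T})"
    if "t \<in> {0..T}" for t
    by (rule velocity_gradient_along_path[OF D A A_cont g H_cont _ r(1) _ that])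
       (use X accel r in auto)
  have sym: "transpose (A (X t, t)) = A (X t, t)" if "t \<in> {0..T}" for t
  proof (rule riccati_preserves_symmetry[OF dA _ _ that])
    show "transpose (A (X 0, 0)) = A (X 0, 0)"
    proof -
      have "partial_deriv i (\<lambda>y. v\<^sub>0 y $ j) a = A (a, 0) $ j $ i" for i j
        using partial_deriv_eq[OF has_derivative_nth[OF v_slice[of 0 a]]] by (simp add: A_entry flip: v_init)
      then show ?thesis using vort by (simp add: vorticity_def vec_eq_iff transpose_def X0)
    qed
  qed (auto intro: H_sym)
  have lin_trace: "bounded_linear (trace :: real^'n^'n \<Rightarrow> real)"
    unfolding linear_conv_bounded_linear[symmetric]
    by (auto simp: linear_iff trace_def sum.distrib sum_distrib_left)
  then interpret lin_trace: bounded_linear "trace :: real^'n^'n \<Rightarrow> real" .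
  show False
  proof (rule riccati_blowup[where T=T and n="real CARD('n)" and d="\<lambda>t. trace (A (X t, t))"
        and d'="\<lambda>t. trace (- k *\<^sub>R H (X t, t) - A (X t, t) ** A (X t, t))"])
    fix t assume t: "t \<in> {0..T}"
    show "((\<lambda>t. trace (A (X t, t))) has_vector_derivative trace (- k *\<^sub>R H (X t, t) - A (X t, t) ** A (X t, t))) (at t within {0..T})"
      by (rule bounded_linear.has_vector_derivative[OF lin_trace dA[OF t]])
    have "trace (- k *\<^sub>R H (X t, t) - A (X t, t) ** A (X t, t)) = - k * \<rho> (X t) t - trace (A (X t, t) ** A (X t, t))"
      using t H_trace[of t "X t"] by (simp add: lin_trace.diff lin_trace.scaleR lin_trace.neg)
    also have "\<dots> \<le> - ((trace (A (X t, t)))\<^sup>2 / real CARD('n))"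
      using trace_square_symmetric[OF sym[OF t]] mult_pos_pos[OF \<open>k > 0\<close> \<rho>_pos[OF t]] by simp
    finally show "trace (- k *\<^sub>R H (X t, t) - A (X t, t) ** A (X t, t)) \<le> - (trace (A (X t, t)))\<^sup>2 / real CARD('n)"
      by simp
  qed (use d0 X0 in \<open>auto simp: T_def\<close>)
qed

end
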